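(* Let $X\subset\mathbb{R}^2$ be a planar self-affine set whose tuple of linear parts is dominated, satisfying the strong separation condition but not the projective open set condition, such that $X_F$ is not a singleton. Then $\dim_A(X)\ge1$.
   Context: An affine iterated function system is a tuple $(\varphi_1,\dots,\varphi_N)$, $N\ge2$, with $\varphi_i(x)=A_ix+v_i$, $A_i\in GL_2(\mathbb{R})$, $\|A_i\|<1$; its self-affine set $X$ is the unique nonempty compact set with $X=\bigcup_i\varphi_i(X)$; properties of $\mathsf{A}=(A_1,\dots,A_N)$ are attributed to $X$. For $\mathtt{i}=i_1\cdots i_n$, $A_{\mathtt{i}}=A_{i_1}\cdots A_{i_n}$, $\varphi_{\mathtt{i}}=\varphi_{i_1}\circ\cdots\circ\varphi_{i_n}$; $\Sigma_*$ is the set of finite words. Dominated: $\exists C>0,0<\tau<1$ with $\alpha_2(A_{\mathtt{i}})\le C\tau^{|\mathtt{i}|}\alpha_1(A_{\mathtt{i}})$ for all $\mathtt{i}\in\Sigma_*$, $\alpha_1\ge\alpha_2$ singular values. Strong separation condition: $\varphi_i(X)\cap\varphi_j(X)=\emptyset$ for $i\ne j$. Furstenberg directions: $X_F=\{A\mathbb{R}^2: A$ rank-one matrix in the closure of $\{cA_{i_1}^{-1}\cdots A_{i_n}^{-1}: c\in\mathbb{R}, i_1\cdots i_n\in\Sigma_*\}\}$. $\operatorname{proj}_W$ is orthogonal projection onto the line $W$. Projective open set condition: there is $\eta>0$ such that for every $V\in X_F$ and $\mathtt{i}\ne\mathtt{j}\in\Sigma_*$ there is $x\in X$ with $|\operatorname{proj}_{V^\perp}(\varphi_{\mathtt{i}}(x))-\operatorname{proj}_{V^\perp}(\varphi_{\mathtt{j}}(x))|\ge\eta\operatorname{diam}(\operatorname{proj}_{V^\perp}(\varphi_{\mathtt{i}}(X)))$.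 Assouad dimension $\dim_A(Y)$: infimum of $s\ge0$ such that for some $C$, for all $x\in Y$, $0<r<R$, $Y\cap B(x,R)$ is covered by at most $C(R/r)^s$ balls of radius $r$ centred in $Y$. *)

theory Defs
  imports "HOL-Analysis.Analysis"
begin

type_synonym vec2 = "real^2"
type_synonym mat2 = "real^2^2"

definition sv1 :: "mat2 \<Rightarrow> real" where
  "sv1 M = onorm (\<lambda>x. M *v x)"

definition sv2 :: "mat2 \<Rightarrow> real" where
  "sv2 M = Inf {norm (M *v x) | x. norm x = 1}"

definition word_mat :: "(nat \<Rightarrow> mat2) \<Rightarrow> nat list \<Rightarrow> mat2" where
  "word_mat A w = foldr (\<lambda>i M. A i ** M) w (mat 1)"

definition word_inv_mat :: "(nat \<Rightarrow> mat2) \<Rightarrow> nat list \<Rightarrow> mat2" where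
  "word_inv_mat A w = foldr (\<lambda>i M. matrix_inv (A i) ** M) w (mat 1)"

definition aff :: "(nat \<Rightarrow> mat2) \<Rightarrow> (nat \<Rightarrow> vec2) \<Rightarrow> nat \<Rightarrow> vec2 \<Rightarrow> vec2" where
  "aff A v i x = A i *v x + v i"

definition word_map :: "(nat \<Rightarrow> mat2) \<Rightarrow> (nat \<Rightarrow> vec2) \<Rightarrow> nat list \<Rightarrow> vec2 \<Rightarrow> vec2" where
  "word_map A v w = foldr (\<lambda>i f. aff A v i \<circ> f) w id"

definition affine_IFS :: "nat \<Rightarrow> (nat \<Rightarrow> mat2) \<Rightarrow> (nat \<Rightarrow> vec2) \<Rightarrow> bool" where
  "affine_IFS N A v \<longleftrightarrow> N \<ge> 2 \<and> (\<forall>i<N. invertible (A i) \<and> sv1 (A i) < 1)"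

definition self_affine_set :: "nat \<Rightarrow> (nat \<Rightarrow> mat2) \<Rightarrow> (nat \<Rightarrow> vec2) \<Rightarrow> vec2 set \<Rightarrow> bool" where
  "self_affine_set N A v X \<longleftrightarrow> affine_IFS N A v \<and> X \<noteq> {} \<and> compact X \<and>
     X = (\<Union>i<N. aff A v i ` X)"

definition dominated :: "nat \<Rightarrow> (nat \<Rightarrow> mat2) \<Rightarrow> bool" where
  "dominated N A \<longleftrightarrow> (\<exists>C>0. \<exists>\<tau>. 0 < \<tau> \<and> \<tau> < 1 \<and>
     (\<forall>w\<in>lists {..<N}. sv2 (word_mat A w) \<le> C * \<tau> ^ length w * sv1 (word_mat A w)))"

definition strong_separation :: "nat \<Rightarrow> (nat \<Rightarrow> mat2) \<Rightarrow> (nat \<Rightarrow> vec2) \<Rightarrow> vec2 set \<Rightarrow> bool" where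
  "strong_separation N A v X \<longleftrightarrow>
     (\<forall>i<N. \<forall>j<N. i \<noteq> j \<longrightarrow> aff A v i ` X \<inter> aff A v j ` X = {})"

definition furstenberg_dirs :: "nat \<Rightarrow> (nat \<Rightarrow> mat2) \<Rightarrow> vec2 set set" where
  "furstenberg_dirs N A =
     {range (\<lambda>x. B *v x) | B. rank B = 1 \<and>
        B \<in> closure {c *\<^sub>R word_inv_mat A w | c w. w \<in> lists {..<N}}}"

definition orth_proj :: "vec2 set \<Rightarrow> vec2 \<Rightarrow> vec2" where
  "orth_proj W x = (THE p. p \<in> W \<and> x - p \<in> orthogonal_comp W)"

definition proj_open_set_condition :: "nat \<Rightarrow> (nat \<Rightarrow> mat2) \<Rightarrow> (nat \<Rightarrow> vec2) \<Rightarrow> vec2 set \<Rightarrow> bool" where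
  "proj_open_set_condition N A v X \<longleftrightarrow> (\<exists>\<eta>>0. \<forall>V\<in>furstenberg_dirs N A.
     \<forall>w\<in>lists {..<N}. \<forall>u\<in>lists {..<N}. w \<noteq> u \<longrightarrow>
       (\<exists>x\<in>X. norm (orth_proj (orthogonal_comp V) (word_map A v w x)
                    - orth_proj (orthogonal_comp V) (word_map A v u x))
               \<ge> \<eta> * diameter (orth_proj (orthogonal_comp V) ` word_map A v w ` X)))"

definition assouad_dim :: "'a::metric_space set \<Rightarrow> real" where
  "assouad_dim Y = Inf {s. s \<ge> 0 \<and> (\<exists>C. \<forall>x\<in>Y. \<forall>r R. 0 < r \<and> r < R \<longrightarrow>
      (\<exists>F. finite F \<and> F \<subseteq> Y \<and> real (card F) \<le> C * (R / r) powr s \<and>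
           Y \<inter> cball x R \<subseteq> (\<Union>y\<in>F. cball y r)))}"

end

(*
  Failure of the projective open set condition yields words I, J for which the maps of I and J are
  distinct but almost equal on X, relative to the norm of the matrix of I. Starting from a single
  point, such pairs are used to build arbitrarily long walks in X: finite sequences of points whose
  steps have comparable lengths and almost the same direction. A walk is moved by the map of a long
  word containing I, and the image of an end point under the word with J in place of I is added as
  a new end point. The word before I is chosen such that all steps become almost parallel, and the
  word after I such that the new step has the size of the old ones. This requires suffixes of words
  that do not contract given vectors much. By domination the rows of the normalized matrices of
  words are essentially determined by the last letters, and their limits are the normals of the
  Furstenberg directions. Two vectors have to be treated at the same time, so three of these
  directions are needed; if there are two, then there is a third one.

  A walk with m steps contains m + 1 points that are separated by a fixed multiple of the size of
  the steps, in a ball whose radius is O(m) times this size. Hence every exponent in the definition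
  of the Assouad dimension is at least 1.
*)
theory Submission
  imports Defs
begin

section \<open>Singular values of planar matrices\<close>

text \<open>The displacement \<open>f I z - f J z\<close> is an affine function of \<open>z\<close>,
  so it may vanish at some points of \<open>X\<close> and turn between others. It is a usable step
  only near a point \<open>y\<close> where its length is maximal. Hence the word after
  \<open>I\<close> has to be a long prefix of an address of \<open>y\<close>. The letters of this
  prefix shrink the old steps, which must not become shorter than the new one, so the displacement
  has to be very small relative to the matrix of \<open>I\<close>. Failure of the projective open
  set condition for every constant provides this, and strong separation ensures that the
  displacement is not identically zero.

  The two vectors that must escape contraction together are the displacement at \<open>y\<close> and
  the image of the common direction of the old steps. Their directions cannot be prescribed, so each
  may be bad for one row.

  The bounds on the relative step lengths depend only on the matrices and survive every extension,
  whereas the relative error in direction may grow by the factor \<open>1 / c^2\<close>. An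
  extension therefore starts from a walk with a smaller tolerance, and the induction on the number
  of steps treats all tolerances at once.\<close>

lemma norm_mult_le_sv1: "norm (M *v x) \<le> sv1 M * norm x"
  unfolding sv1_def by (rule onorm) simp

lemma sv1_nonneg [simp]: "0 \<le> sv1 M"
  unfolding sv1_def by (rule onorm_pos_le) simp

lemma sv1_le:
  assumes "\<And>x. norm (M *v x) \<le> b * norm x"
  shows "sv1 M \<le> b"
  unfolding sv1_def using assms by (rule onorm_le)

lemma sv2_bdd_below: "bdd_below {norm (M *v x) | x. norm x = 1}"
  by (rule bdd_belowI[of _ 0]) auto

lemma sv2_le_norm:
  assumes "norm x = 1"
  shows "sv2 M \<le> norm (M *v x)"
  unfolding sv2_def using assms by (intro cInf_lower sv2_bdd_below) auto

lemma sv2_ge: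
  assumes "\<And>x. norm x = 1 \<Longrightarrow> b \<le> norm (M *v x)"
  shows "b \<le> sv2 M"
proof -
  have "norm (axis 1 1 :: vec2) = 1" by simp
  then have "{norm (M *v x) | x. norm x = 1} \<noteq> {}" by blast
  then show ?thesis
    unfolding sv2_def by (rule cInf_greatest) (use assms in blast)
qed

lemma sv2_mult_le: "sv2 M * norm x \<le> norm (M *v x)"
proof (cases "x = 0")
  case False
  have "sv2 M \<le> norm (M *v (inverse (norm x) *\<^sub>R x))"
    using False by (intro sv2_le_norm) simp
  also have "\<dots> = inverse (norm x) * norm (M *v x)"
    by (simp add: matrix_vector_mult_scaleR)
  finally show ?thesis using False by (simp add: field_simps)
qed simp

lemma sv2_nonneg [simp]: "0 \<le> sv2 M"
  by (rule sv2_ge) simp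

lemma sv2_attained:
  obtains s where "norm s = 1" "norm (M *v s) = sv2 M"
proof -
  have "sphere (0::vec2) 1 \<noteq> {}" by simp
  moreover have "continuous_on (sphere 0 1) (\<lambda>x. norm (M *v x))"
    by (intro continuous_on_norm linear_continuous_on) simp
  ultimately obtain s where s: "s \<in> sphere 0 1"
    and min: "\<And>x. x \<in> sphere 0 1 \<Longrightarrow> norm (M *v s) \<le> norm (M *v x)"
    using continuous_attains_inf[OF compact_sphere] by metis
  have "norm (M *v s) \<le> sv2 M"
    by (rule sv2_ge) (use min in simp)
  moreover have "sv2 M \<le> norm (M *v s)"
    using s by (intro sv2_le_norm) simp
  ultimately show ?thesis using s that by force
qed

lemma sv2_le_sv1: "sv2 M \<le> sv1 M"
proof -
  obtain s where "norm s = 1" "norm (M *v s) = sv2 M" by (rule sv2_attained)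
  then show ?thesis using norm_mult_le_sv1[of M s] by simp
qed

lemma sv2_pos:
  assumes "invertible M"
  shows "0 < sv2 M"
proof -
  obtain s where s: "norm s = 1" "norm (M *v s) = sv2 M" by (rule sv2_attained)
  obtain L where "L ** M = mat 1" using assms invertible_def by blast
  then have "L *v (M *v s) = s" by (simp add: matrix_vector_mul_assoc)
  then have "M *v s \<noteq> 0" using s by auto
  then show ?thesis using s(2) by (metis zero_less_norm_iff)
qed

text \<open>If \<open>sv2 L > 0\<close>, then every \<open>z\<close> equals \<open>L *v y\<close>
  with \<open>norm y \<le> norm z / sv2 L\<close>. This bound and its mirror image below replace
  multiplicativity of \<open>sv1\<close>: a fixed word on either side of a product costs only a
  constant factor.\<close>

lemma sv1_mult_sv2_le: "sv1 M * sv2 L \<le> sv1 (M ** L)"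
proof (cases "sv2 L = 0")
  case False
  then have pos: "sv2 L > 0" by (simp add: order_less_le)
  have "\<exists>y. L *v y = z" for z
  proof -
    have "inj ((*v) L)"
    proof (rule injI)
      fix x y assume "L *v x = L *v y"
      then have "norm (L *v (x - y)) = 0" by (simp add: matrix_vector_mult_diff_distrib)
      then have "sv2 L * norm (x - y) \<le> 0" using sv2_mult_le[of L "x - y"] by simp
      then show "x = y" using pos by (simp add: mult_le_0_iff)
    qed
    then have "surj ((*v) L)"
      using linear_injective_imp_surjective[OF matrix_vector_mul_linear] by blast
    then show ?thesis by (metis surjD)
  qed
  have "sv1 M \<le> sv1 (M ** L) / sv2 L"
  proof (rule sv1_le)
    fix z
    obtain y where y: "L *v y = z" using \<open>\<And>z. \<exists>y. L *v y = z\<close> by blast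
    have "norm (M *v z) \<le> sv1 (M ** L) * norm y"
      using norm_mult_le_sv1[of "M ** L" y] y by (simp add: matrix_vector_mul_assoc[symmetric])
    moreover have "norm y \<le> norm z / sv2 L"
      using sv2_mult_le[of L y] y pos by (simp add: field_simps)
    ultimately show "norm (M *v z) \<le> sv1 (M ** L) / sv2 L * norm z"
      using mult_left_mono[of "norm y" "norm z / sv2 L" "sv1 (M ** L)"] by simp
  qed
  then show ?thesis using pos by (simp add: field_simps)
qed simp

lemma sv2_mult_sv1_le: "sv2 M * sv1 L \<le> sv1 (M ** L)"
proof (cases "sv2 M = 0")
  case False
  then have pos: "sv2 M > 0" by (simp add: order_less_le)
  have "sv1 L \<le> sv1 (M ** L) / sv2 M"
  proof (rule sv1_le)
    fix x
    have "sv2 M * norm (L *v x) \<le> norm (M *v (L *v x))" by (rule sv2_mult_le)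
    also have "\<dots> \<le> sv1 (M ** L) * norm x"
      using norm_mult_le_sv1[of "M ** L" x] by (simp add: matrix_vector_mul_assoc)
    finally show "norm (L *v x) \<le> sv1 (M ** L) / sv2 M * norm x"
      using pos by (simp add: field_simps)
  qed
  then show ?thesis using pos by (simp add: field_simps)
qed simp

section \<open>Frames, cross products and dual vectors in the plane\<close>

definition rot :: "vec2 \<Rightarrow> vec2" where
  "rot z = vector [- z $ 2, z $ 1]"

lemma rot_component [simp]: "rot z $ 1 = - z $ 2" "rot z $ 2 = z $ 1"
  by (simp_all add: rot_def)

lemma inner_vec2: "(x::vec2) \<bullet> y = x $ 1 * y $ 1 + x $ 2 * y $ 2"
  by (simp add: inner_vec_def sum_2)

lemma norm_rot [simp]: "norm (rot z) = norm z"
  by (simp add: norm_eq_sqrt_inner inner_vec2)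

lemma rot_frame:
  assumes "norm s = 1"
  shows "z = (s \<bullet> z) *\<^sub>R s + (rot s \<bullet> z) *\<^sub>R rot s"
proof -
  have 1: "s $ 1 * s $ 1 + s $ 2 * s $ 2 = 1"
    using assms by (simp add: norm_eq_1 inner_vec2)
  have "((s \<bullet> z) *\<^sub>R s + (rot s \<bullet> z) *\<^sub>R rot s) $ 1 = (s $ 1 * s $ 1 + s $ 2 * s $ 2) * z $ 1"
    "((s \<bullet> z) *\<^sub>R s + (rot s \<bullet> z) *\<^sub>R rot s) $ 2 = (s $ 1 * s $ 1 + s $ 2 * s $ 2) * z $ 2"
    by (simp_all add: inner_vec2 algebra_simps)
  then show ?thesis
    unfolding 1 by (simp add: vec_eq_iff forall_2)
qed

lemma abs_inner_le_1:
  assumes "norm s = 1"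
  shows "\<bar>s \<bullet> z\<bar> \<le> norm z"
  using Cauchy_Schwarz_ineq2[of s z] assms by simp

text \<open>Off the direction \<^term>\<open>s\<close> that \<^term>\<open>M\<close> contracts most, \<^term>\<open>L ** M\<close> acts
  like a rank one matrix whose row direction does not depend on \<^term>\<open>L\<close>.\<close>
lemma relative_gain:
  assumes s: "norm s = 1" "norm (M *v s) = sv2 M" and z: "norm z = 1"
  shows "\<bar>norm ((L ** M) *v z) - \<bar>rot s \<bullet> z\<bar> * sv1 (L ** M)\<bar> \<le> 2 * (sv1 L * sv2 M)"
proof -
  let ?N = "L ** M" and ?e = "sv1 L * sv2 M" and ?p = "rot s"
  have e: "norm (?N *v s) \<le> ?e"
    using norm_mult_le_sv1[of L "M *v s"] s by (simp add: matrix_vector_mul_assoc)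
  have e0: "0 \<le> ?e" by simp
  \<comment> \<open>Only the component of \<open>x\<close> along \<open>s\<close> is neglected here;
    its image has norm at most \<open>norm x * ?e\<close>, because \<open>M\<close> contracts
    \<open>s\<close> to length \<open>sv2 M\<close>.\<close>
  have dec: "norm (?N *v x - (?p \<bullet> x) *\<^sub>R (?N *v ?p)) \<le> norm x * ?e" for x
  proof -
    have "?N *v x - (?p \<bullet> x) *\<^sub>R (?N *v ?p) = (s \<bullet> x) *\<^sub>R (?N *v s)"
      by (subst rot_frame[OF s(1), of x])
        (simp add: matrix_vector_right_distrib matrix_vector_mult_scaleR)
    then show ?thesis
      using abs_inner_le_1[OF s(1), of x] e mult_mono[OF _ e, of "\<bar>s \<bullet> x\<bar>" "norm x"] by simp
  qed
  have p1: "norm ?p = 1" using s by simp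
  have up: "sv1 ?N \<le> norm (?N *v ?p) + ?e"
  proof (rule sv1_le)
    fix x
    have "norm (?N *v x) \<le> \<bar>?p \<bullet> x\<bar> * norm (?N *v ?p) + norm x * ?e"
      using dec[of x] norm_triangle_ineq2[of "?N *v x" "(?p \<bullet> x) *\<^sub>R (?N *v ?p)"] by simp
    also have "\<bar>?p \<bullet> x\<bar> * norm (?N *v ?p) \<le> norm x * norm (?N *v ?p)"
      by (intro mult_right_mono abs_inner_le_1 p1) simp
    finally show "norm (?N *v x) \<le> (norm (?N *v ?p) + ?e) * norm x"
      by (simp add: algebra_simps)
  qed
  have lo: "norm (?N *v ?p) \<le> sv1 ?N"
    using norm_mult_le_sv1[of ?N ?p] p1 by simp
  let ?b = "\<bar>?p \<bullet> z\<bar>"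
  have b: "0 \<le> ?b" "?b \<le> 1" using abs_inner_le_1[OF p1, of z] z by auto
  have "\<bar>norm (?N *v z) - ?b * norm (?N *v ?p)\<bar> \<le> ?e"
    using dec[of z] z norm_triangle_ineq3[of "?N *v z" "(?p \<bullet> z) *\<^sub>R (?N *v ?p)"] by simp
  moreover have "\<bar>?b * norm (?N *v ?p) - ?b * sv1 ?N\<bar> \<le> ?e"
  proof -
    have "\<bar>?b * norm (?N *v ?p) - ?b * sv1 ?N\<bar> = ?b * \<bar>norm (?N *v ?p) - sv1 ?N\<bar>"
      by (simp add: right_diff_distrib[symmetric] abs_mult)
    also have "\<dots> \<le> 1 * ?e" using up lo b e0 by (intro mult_mono) auto
    finally show ?thesis by simp
  qed
  ultimately show ?thesis by linarith
qed

definition crossp :: "vec2 \<Rightarrow> vec2 \<Rightarrow> real" where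
  "crossp u w = u $ 1 * w $ 2 - u $ 2 * w $ 1"

lemma crossp_commute: "crossp w u = - crossp u w"
  by (simp add: crossp_def)

lemma crossp_eq_0_imp_parallel:
  assumes "crossp u w = 0" "u \<noteq> 0"
  obtains l where "w = l *\<^sub>R u"
proof (cases "u $ 1 = 0")
  case True
  then have "u $ 2 \<noteq> 0" using assms(2) by (simp add: vec_eq_iff forall_2)
  then show ?thesis using assms(1) True
    by (intro that[of "w $ 2 / u $ 2"]) (auto simp: vec_eq_iff forall_2 crossp_def)
next
  case False
  then show ?thesis using assms(1)
    by (intro that[of "w $ 1 / u $ 1"]) (auto simp: vec_eq_iff forall_2 crossp_def field_simps)
qed

lemma dual_vector:
  assumes "crossp u w \<noteq> 0"
  obtains z where "u \<bullet> z = 1" "w \<bullet> z = 0"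
proof
  let ?y = "vector [w $ 2, - w $ 1] :: vec2"
  have y: "u \<bullet> ?y = crossp u w" "w \<bullet> ?y = 0"
    by (simp_all add: inner_vec2 crossp_def algebra_simps)
  show "u \<bullet> ((1 / crossp u w) *\<^sub>R ?y) = 1" "w \<bullet> ((1 / crossp u w) *\<^sub>R ?y) = 0"
    using assms by (simp_all add: y)
qed

lemma norm_le_of_functionals:
  assumes "crossp u w \<noteq> 0"
  obtains K where "K > 0" "\<And>z. norm z \<le> K * max \<bar>u \<bullet> z\<bar> \<bar>w \<bullet> z\<bar>"
proof -
  obtain p where p: "u \<bullet> p = 1" "w \<bullet> p = 0" using dual_vector[OF assms] by blast
  obtain q where q: "w \<bullet> q = 1" "u \<bullet> q = 0"
    using dual_vector[of w u] assms by (metis crossp_commute neg_equal_0_iff_equal)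
  have uniq: "z = 0" if "u \<bullet> z = 0" "w \<bullet> z = 0" for z
  proof -
    \<comment> \<open>Cramer's rule, solving for the coordinates of \<open>z\<close> from the two
      inner products.\<close>
    have "crossp u w * z $ 1 = w $ 2 * (u \<bullet> z) - u $ 2 * (w \<bullet> z)"
      "crossp u w * z $ 2 = u $ 1 * (w \<bullet> z) - w $ 1 * (u \<bullet> z)"
      by (simp_all add: crossp_def inner_vec2 algebra_simps)
    then show ?thesis using that assms by (simp add: vec_eq_iff forall_2)
  qed
  have eq: "z = (u \<bullet> z) *\<^sub>R p + (w \<bullet> z) *\<^sub>R q" for z
    using uniq[of "z - ((u \<bullet> z) *\<^sub>R p + (w \<bullet> z) *\<^sub>R q)"] p q
    by (simp add: inner_diff_right inner_add_right)
  show ?thesis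
  proof (rule that[of "norm p + norm q"])
    show "0 < norm p + norm q" using p by (metis add_pos_nonneg inner_zero_right norm_ge_zero zero_less_norm_iff zero_neq_one)
    fix z
    have "norm z \<le> \<bar>u \<bullet> z\<bar> * norm p + \<bar>w \<bullet> z\<bar> * norm q"
      using eq[of z] norm_triangle_ineq[of "(u \<bullet> z) *\<^sub>R p" "(w \<bullet> z) *\<^sub>R q"] by simp
    also have "\<dots> \<le> max \<bar>u \<bullet> z\<bar> \<bar>w \<bullet> z\<bar> * norm p + max \<bar>u \<bullet> z\<bar> \<bar>w \<bullet> z\<bar> * norm q"
      by (intro add_mono mult_right_mono) auto
    finally show "norm z \<le> (norm p + norm q) * max \<bar>u \<bullet> z\<bar> \<bar>w \<bullet> z\<bar>"
      by (simp add: algebra_simps)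
  qed
qed

section \<open>Dominated matrix products\<close>

lemma word_mat_Nil [simp]: "word_mat A [] = mat 1"
  by (simp add: word_mat_def)

lemma word_mat_Cons [simp]: "word_mat A (i # w) = A i ** word_mat A w"
  by (simp add: word_mat_def)

lemma word_mat_append: "word_mat A (w @ u) = word_mat A w ** word_mat A u"
  by (induction w) (simp_all add: matrix_mul_assoc)

lemma word_map_Nil [simp]: "word_map A v [] = id"
  by (simp add: word_map_def)

lemma word_map_Cons [simp]: "word_map A v (i # w) = aff A v i \<circ> word_map A v w"
  by (simp add: word_map_def)

lemma word_map_append: "word_map A v (w @ u) = word_map A v w \<circ> word_map A v u"
  by (induction w) (simp_all add: comp_assoc)

lemma word_map_diff: "word_map A v w x - word_map A v w y = word_mat A w *v (x - y)"
proof (induction w)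
  case (Cons i w)
  have "word_map A v (i # w) x - word_map A v (i # w) y
      = A i *v (word_map A v w x - word_map A v w y)"
    by (simp add: aff_def matrix_vector_mult_diff_distrib)
  then show ?case unfolding Cons by (simp add: matrix_vector_mul_assoc)
qed simp

text \<open>The rank one matrix with rows parallel to \<^term>\<open>u\<close> and columns parallel to \<^term>\<open>e\<close> is a limit of
  multiples of products. Taking inverses, its kernel is a Furstenberg direction.\<close>
definition limit_row :: "nat \<Rightarrow> (nat \<Rightarrow> mat2) \<Rightarrow> vec2 \<Rightarrow> bool" where
  "limit_row N A u \<longleftrightarrow> u \<noteq> 0 \<and> (\<exists>e. e \<noteq> 0 \<and> (\<forall>\<epsilon>>0. \<exists>w\<in>lists {..<N}. \<exists>c.
     \<forall>z. norm (c *\<^sub>R (word_mat A w *v z) - (u \<bullet> z) *\<^sub>R e) \<le> \<epsilon> * norm z))"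

text \<open>The division removes the unknown scalar \<open>c\<close> of \<open>limit_row\<close>.
  For a rank one matrix with row \<open>u\<close> and a unit vector \<open>z\<close> this quotient
  is the absolute cosine of the angle between \<open>u\<close> and \<open>z\<close>.\<close>

definition gain :: "(nat \<Rightarrow> mat2) \<Rightarrow> vec2 \<Rightarrow> nat list \<Rightarrow> real" where
  "gain A z w = norm (word_mat A w *v z) / sv1 (word_mat A w)"

section \<open>Products of uniformly invertible contractions and their rank one limits\<close>

locale contracting_matrices =
  fixes N :: nat and A :: "nat \<Rightarrow> mat2" and \<kappa> \<rho> :: real
  assumes kappa: "0 < \<kappa>" "\<kappa> \<le> 1" and rho: "0 < \<rho>" "\<rho> < 1"
    and expand: "i < N \<Longrightarrow> \<kappa> * norm z \<le> norm (A i *v z)"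
    and contract: "i < N \<Longrightarrow> norm (A i *v z) \<le> \<rho> * norm z"
begin

abbreviation "W \<equiv> lists {..<N}"
abbreviation "M \<equiv> word_mat A"

lemma norm_word_le: "w \<in> W \<Longrightarrow> norm (M w *v z) \<le> \<rho> ^ length w * norm z"
proof (induction w)
  case (Cons i w)
  have "norm (A i *v (M w *v z)) \<le> \<rho> * norm (M w *v z)"
    using Cons.prems by (intro contract) simp
  also have "\<dots> \<le> \<rho> * (\<rho> ^ length w * norm z)"
    using Cons rho by (intro mult_left_mono) auto
  finally show ?case by (simp add: matrix_vector_mul_assoc)
qed simp

lemma norm_word_ge: "w \<in> W \<Longrightarrow> \<kappa> ^ length w * norm z \<le> norm (M w *v z)"
proof (induction w)
  case (Cons i w)
  have "\<kappa> * (\<kappa> ^ length w * norm z) \<le> \<kappa> * norm (M w *v z)"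
    using Cons kappa by (intro mult_left_mono) auto
  also have "\<dots> \<le> norm (A i *v (M w *v z))"
    using Cons.prems by (intro expand) simp
  finally show ?case by (simp add: matrix_vector_mul_assoc)
qed simp

lemma norm_word_le_norm: "w \<in> W \<Longrightarrow> norm (M w *v z) \<le> norm z"
  using norm_word_le[of w z] power_le_one[of \<rho> "length w"] rho
    mult_right_mono[of "\<rho> ^ length w" 1 "norm z"] by force

lemma sv1_word_le: "w \<in> W \<Longrightarrow> sv1 (M w) \<le> \<rho> ^ length w"
  by (rule sv1_le) (rule norm_word_le)

lemma sv2_word_ge: "w \<in> W \<Longrightarrow> \<kappa> ^ length w \<le> sv2 (M w)"
  using norm_word_ge[of w] by (intro sv2_ge) (metis mult.right_neutral)

lemma sv2_word_pos: "w \<in> W \<Longrightarrow> 0 < sv2 (M w)"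
  using sv2_word_ge kappa by (meson less_le_trans zero_less_power)

lemma sv1_word_pos: "w \<in> W \<Longrightarrow> 0 < sv1 (M w)"
  using sv2_word_pos sv2_le_sv1 less_le_trans by blast

lemma word_mat_eq_0_iff: "w \<in> W \<Longrightarrow> M w *v z = 0 \<longleftrightarrow> z = 0"
proof
  assume w: "w \<in> W" and "M w *v z = 0"
  then have "\<kappa> ^ length w * norm z \<le> 0" using norm_word_ge[of w z] by simp
  moreover have "0 < \<kappa> ^ length w" using kappa by simp
  ultimately show "z = 0" by (simp add: mult_le_0_iff not_le[symmetric])
qed simp

text \<open>For words shorter than \<open>n\<close> the ratio of the singular values is at most
  \<open>1 / \<kappa> ^ n\<close>, which keeps their multiples away from a rank one matrix. Length
  matters because the error in \<open>gain_append\<close> decays with the length of the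
  suffix.\<close>

lemma limit_row_long:
  assumes "u \<noteq> 0" "e \<noteq> 0"
  obtains \<delta> where "\<delta> > 0"
    "\<And>w c. \<lbrakk>w \<in> W; \<And>z. norm (c *\<^sub>R (M w *v z) - (u \<bullet> z) *\<^sub>R e) \<le> \<delta> * norm z\<rbrakk> \<Longrightarrow> n \<le> length w"
proof
  let ?T = "norm u * norm e" and ?k = "1 + 1 / \<kappa> ^ n"
  let ?\<delta> = "?T / (2 * ?k)"
  have k: "?k > 0" using kappa by (simp add: add_pos_pos)
  have T: "?T > 0" using assms by simp
  show "?\<delta> > 0" using T k by simp
  fix w c assume w: "w \<in> W"
    and ap: "\<And>z. norm (c *\<^sub>R (M w *v z) - (u \<bullet> z) *\<^sub>R e) \<le> ?\<delta> * norm z"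
  show "n \<le> length w"
  proof (rule ccontr)
    assume "\<not> n \<le> length w"
    then have kn: "\<kappa> ^ n \<le> \<kappa> ^ length w" using kappa by (intro power_decreasing) auto
    \<comment> \<open>The kernel vector \<open>rot u\<close> gives an upper bound for the modulus of
      \<open>c\<close>; the vector \<open>u\<close> bounds \<open>?T\<close>, the norm of the rank
      one matrix, by that modulus plus \<open>?\<delta>\<close>. The choice of
      \<open>?\<delta>\<close> turns the two into \<open>?T \<le> ?T / 2\<close>.\<close>
    have "u \<bullet> rot u = 0" by (simp add: inner_vec2)
    then have "\<bar>c\<bar> * norm (M w *v rot u) \<le> ?\<delta> * norm u" using ap[of "rot u"] by simp
    moreover have "\<bar>c\<bar> * (\<kappa> ^ n * norm u) \<le> \<bar>c\<bar> * norm (M w *v rot u)"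
      using norm_word_ge[OF w, of "rot u"] mult_right_mono[OF kn, of "norm u"]
      by (intro mult_left_mono) auto
    ultimately have "\<bar>c\<bar> * \<kappa> ^ n * norm u \<le> ?\<delta> * norm u" by simp
    then have "\<bar>c\<bar> * \<kappa> ^ n \<le> ?\<delta>"
      using assms(1) by (simp only: mult_le_cancel_right zero_less_norm_iff) simp
    then have "\<bar>c\<bar> \<le> ?\<delta> / \<kappa> ^ n" using kappa by (subst pos_le_divide_eq) auto
    moreover have "?T * norm u \<le> (\<bar>c\<bar> + ?\<delta>) * norm u"
    proof -
      have "norm ((u \<bullet> u) *\<^sub>R e) \<le> norm (c *\<^sub>R (M w *v u)) + ?\<delta> * norm u"
        using ap[of u] norm_triangle_ineq3[of "c *\<^sub>R (M w *v u)" "(u \<bullet> u) *\<^sub>R e"] by linarith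
      also have "norm (c *\<^sub>R (M w *v u)) \<le> \<bar>c\<bar> * norm u"
        using norm_word_le_norm[OF w, of u] by (simp add: mult_left_mono)
      finally show ?thesis
        by (simp add: dot_square_norm power2_eq_square algebra_simps)
    qed
    then have "?T \<le> \<bar>c\<bar> + ?\<delta>"
      using assms(1) by (simp only: mult_le_cancel_right zero_less_norm_iff) simp
    moreover have "?\<delta> * ?k = ?\<delta> + ?\<delta> / \<kappa> ^ n"
      by (simp only: distrib_left mult_1_right times_divide_eq_right)
    ultimately have "?T \<le> ?\<delta> * ?k" by linarith
    also have "\<dots> = ?T / 2" using k
      by (metis (no_types, lifting) divide_divide_eq_left less_irrefl nonzero_eq_divide_eq)
    finally show False using T by linarith
  qed
qed

text \<open>The approximation forces the modulus of \<open>c\<close> times \<open>sv1 (M w)\<close>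
  to be within \<open>\<delta>\<close> of \<open>norm u * norm e\<close>, so that forming the
  quotient cancels both \<open>c\<close> and \<open>e\<close>.\<close>

lemma limit_row_gain:
  assumes "limit_row N A u" "\<epsilon> > 0"
  obtains w where "w \<in> W" "n \<le> length w"
    "\<And>z. norm z = 1 \<Longrightarrow> \<bar>gain A z w - \<bar>u \<bullet> z\<bar> / norm u\<bar> \<le> \<epsilon>"
proof -
  obtain e where u: "u \<noteq> 0" and e: "e \<noteq> 0" and
    lim: "\<And>\<epsilon>. \<epsilon> > 0 \<Longrightarrow> \<exists>w\<in>W. \<exists>c. \<forall>z. norm (c *\<^sub>R (M w *v z) - (u \<bullet> z) *\<^sub>R e) \<le> \<epsilon> * norm z"
    using assms unfolding limit_row_def by blast
  obtain \<delta>0 where d0: "\<delta>0 > 0" and long: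
    "\<And>w c. \<lbrakk>w \<in> W; \<And>z. norm (c *\<^sub>R (M w *v z) - (u \<bullet> z) *\<^sub>R e) \<le> \<delta>0 * norm z\<rbrakk> \<Longrightarrow> n \<le> length w"
    using limit_row_long[OF u e] by metis
  let ?T = "norm u * norm e"
  have T: "?T > 0" using u e by simp
  define \<delta> where "\<delta> = min \<delta>0 (min (?T / 2) (\<epsilon> * ?T / 4))"
  have d: "\<delta> > 0" "\<delta> \<le> \<delta>0" "\<delta> \<le> ?T / 2" "\<delta> \<le> \<epsilon> * ?T / 4"
    using d0 T assms(2) by (auto simp: \<delta>_def)
  obtain w c where w: "w \<in> W" and
    ap: "\<And>z. norm (c *\<^sub>R (M w *v z) - (u \<bullet> z) *\<^sub>R e) \<le> \<delta> * norm z"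
    using lim[OF d(1)] by blast
  show ?thesis
  proof (rule that[OF w])
    show "n \<le> length w"
    proof (rule long[OF w])
      fix z show "norm (c *\<^sub>R (M w *v z) - (u \<bullet> z) *\<^sub>R e) \<le> \<delta>0 * norm z"
        using ap[of z] d(2) mult_right_mono[of \<delta> \<delta>0 "norm z"] by force
    qed
    fix z :: vec2 assume z: "norm z = 1"
    let ?S = "\<bar>c\<bar> * sv1 (M w)" and ?b = "\<bar>u \<bullet> z\<bar> / norm u"
    have ap': "\<bar>\<bar>c\<bar> * norm (M w *v z) - \<bar>u \<bullet> z\<bar> * norm e\<bar> \<le> \<delta> * norm z" for z
      using ap[of z] norm_triangle_ineq3[of "c *\<^sub>R (M w *v z)" "(u \<bullet> z) *\<^sub>R e"] by simp
    have lo: "?T - \<delta> \<le> ?S"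
    proof -
      have "\<bar>u \<bullet> u\<bar> * norm e \<le> \<bar>c\<bar> * norm (M w *v u) + \<delta> * norm u"
        using ap'[of u] by linarith
      also have "\<bar>c\<bar> * norm (M w *v u) \<le> \<bar>c\<bar> * (sv1 (M w) * norm u)"
        by (intro mult_left_mono norm_mult_le_sv1) simp
      finally have "?T * norm u \<le> (?S + \<delta>) * norm u"
        by (simp add: dot_square_norm power2_eq_square algebra_simps)
      then have "?T \<le> ?S + \<delta>" using u by (simp only: mult_le_cancel_right zero_less_norm_iff) simp
      then show ?thesis by linarith
    qed
    have c: "c \<noteq> 0" using lo d T by auto
    have up: "?S \<le> ?T + \<delta>"
    proof -
      have "sv1 (M w) \<le> (?T + \<delta>) / \<bar>c\<bar>"
      proof (rule sv1_le)
        fix x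
        have "\<bar>c\<bar> * norm (M w *v x) \<le> \<bar>u \<bullet> x\<bar> * norm e + \<delta> * norm x"
          using ap'[of x] by linarith
        also have "\<bar>u \<bullet> x\<bar> * norm e \<le> (norm u * norm x) * norm e"
          by (intro mult_right_mono Cauchy_Schwarz_ineq2) simp
        finally show "norm (M w *v x) \<le> (?T + \<delta>) / \<bar>c\<bar> * norm x"
          using c by (simp add: field_simps)
      qed
      then show ?thesis using c by (simp add: field_simps)
    qed
    have b: "0 \<le> ?b" "?b \<le> 1"
      using Cauchy_Schwarz_ineq2[of u z] z u by (auto simp: divide_le_eq)
    have S: "?S > 0" using lo d T by linarith
    have gS: "gain A z w * ?S = \<bar>c\<bar> * norm (M w *v z)"
      using S c by (auto simp: gain_def)
    have bT: "?b * ?T = \<bar>u \<bullet> z\<bar> * norm e" using u by simp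
    have "\<bar>gain A z w * ?S - ?b * ?T\<bar> \<le> \<delta>" unfolding gS bT using ap'[of z] z by simp
    moreover have "\<bar>?b * (?T - ?S)\<bar> \<le> 1 * \<delta>"
      unfolding abs_mult using b lo up by (intro mult_mono) auto
    moreover have "(gain A z w - ?b) * ?S = (gain A z w * ?S - ?b * ?T) + ?b * (?T - ?S)"
      by (simp add: algebra_simps)
    ultimately have "\<bar>(gain A z w - ?b) * ?S\<bar> \<le> 2 * \<delta>"
      using abs_triangle_ineq[of "gain A z w * ?S - ?b * ?T" "?b * (?T - ?S)"] by (simp only:)
    then have "\<bar>gain A z w - ?b\<bar> * ?S \<le> 2 * \<delta>" using S by (simp add: abs_mult)
    moreover have "\<bar>gain A z w - ?b\<bar> * (?T / 2) \<le> \<bar>gain A z w - ?b\<bar> * ?S"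
      using lo d by (intro mult_left_mono) auto
    ultimately have "\<bar>gain A z w - ?b\<bar> * (?T / 2) \<le> \<epsilon> * (?T / 2)" using d by linarith
    then show "\<bar>gain A z w - ?b\<bar> \<le> \<epsilon>" using T by (simp add: mult_le_cancel_right)
  qed
qed

lemma letter_surj:
  assumes "i < N"
  shows "\<exists>z. A i *v z = y"
proof -
  have "inj ((*v) (A i))"
  proof (rule injI)
    fix x y assume "A i *v x = A i *v y"
    then have "norm (A i *v (x - y)) = 0" by (simp add: matrix_vector_mult_diff_distrib)
    then have "\<kappa> * norm (x - y) \<le> 0" using expand[OF assms, of "x - y"] by simp
    then show "x = y" using kappa by (simp add: mult_le_0_iff)
  qed
  then have "surj ((*v) (A i))"
    using linear_injective_imp_surjective[OF matrix_vector_mul_linear] by blast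
  then show ?thesis by (metis surjD)
qed

text \<open>Appending the letter to the approximating words multiplies the row by \<open>A i\<close>
  and keeps the column \<open>e\<close>. Thus the letters act on the set of limit rows, which is
  what produces a third line from two.\<close>

lemma limit_row_letter:
  assumes "limit_row N A u" "i < N"
  shows "limit_row N A (u v* A i)"
proof -
  obtain e where u: "u \<noteq> 0" and e: "e \<noteq> 0" and
    lim: "\<And>\<epsilon>. \<epsilon> > 0 \<Longrightarrow> \<exists>w\<in>W. \<exists>c. \<forall>z. norm (c *\<^sub>R (M w *v z) - (u \<bullet> z) *\<^sub>R e) \<le> \<epsilon> * norm z"
    using assms unfolding limit_row_def by blast
  have "u v* A i \<noteq> 0"
  proof
    assume 0: "u v* A i = 0"
    obtain z where "A i *v z = u" using letter_surj[OF assms(2)] by blast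
    then have "u \<bullet> u = 0" using dot_lmul_matrix[of u "A i" z] 0 by simp
    then show False using u by simp
  qed
  moreover have "\<exists>w\<in>W. \<exists>c. \<forall>z. norm (c *\<^sub>R (M w *v z) - ((u v* A i) \<bullet> z) *\<^sub>R e) \<le> \<epsilon> * norm z"
    if eps: "\<epsilon> > 0" for \<epsilon>
  proof -
    obtain w c where w: "w \<in> W" and
      ap: "\<And>z. norm (c *\<^sub>R (M w *v z) - (u \<bullet> z) *\<^sub>R e) \<le> \<epsilon> * norm z"
      using lim[OF eps] by blast
    have "norm (c *\<^sub>R (M (w @ [i]) *v z) - ((u v* A i) \<bullet> z) *\<^sub>R e) \<le> \<epsilon> * norm z" for z
    proof -
      have "norm (A i *v z) \<le> norm z"
        using norm_word_le_norm[of "[i]" z] assms(2) by simp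
      then show ?thesis
        using order_trans[OF ap[of "A i *v z"] mult_left_mono[of "norm (A i *v z)" "norm z" \<epsilon>]] eps
        by (simp add: word_mat_append dot_lmul_matrix matrix_vector_mul_assoc[symmetric])
    qed
    moreover have "w @ [i] \<in> W" using w assms(2) by simp
    ultimately show ?thesis by blast
  qed
  ultimately show ?thesis unfolding limit_row_def using e by blast
qed

end

section \<open>Domination: gains depend mainly on the last letters\<close>

locale dominated_matrices = contracting_matrices +
  fixes C \<tau> :: real
  assumes C: "0 < C" and tau: "0 < \<tau>" "\<tau> < 1"
    and domination: "w \<in> lists {..<N} \<Longrightarrow>
      sv2 (word_mat A w) \<le> C * \<tau> ^ length w * sv1 (word_mat A w)"
begin

text \<open>Applied with \<open>L = mat 1\<close> and with \<open>L = A i\<close>,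
  \<open>relative_gain\<close> compares both gains with the same number, given by the direction
  \<open>s\<close> that \<open>M w\<close> contracts most. The new letter may reduce the norm of the
  product by the factor \<open>\<kappa>\<close>, hence the summand
  \<open>2 / \<kappa>\<close>.\<close>

lemma gain_Cons:
  assumes z: "norm z = 1" and i: "i < N" and w: "w \<in> W"
  shows "\<bar>gain A z (i # w) - gain A z w\<bar> \<le> (2 + 2 / \<kappa>) * C * \<tau> ^ length w"
proof -
  obtain s where s: "norm s = 1" "norm (M w *v s) = sv2 (M w)" by (rule sv2_attained)
  let ?b = "\<bar>rot s \<bullet> z\<bar>"
  have pos: "0 < sv1 (M w)" using sv1_word_pos[OF w] .
  have iw: "i # w \<in> W" using i w by simp
  have pos': "0 < sv1 (M (i # w))" using sv1_word_pos[OF iw] .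
  have dom: "sv2 (M w) / sv1 (M w) \<le> C * \<tau> ^ length w"
    using domination[OF w] pos by (simp add: divide_le_eq)
  have "sv1 (mat 1) \<le> 1" by (rule sv1_le) simp
  then have "\<bar>norm (M w *v z) - ?b * sv1 (M w)\<bar> \<le> 2 * sv2 (M w)"
    using relative_gain[OF s z, of "mat 1"] mult_right_mono[of "sv1 (mat 1)" 1 "sv2 (M w)"] by simp
  then have "\<bar>gain A z w - ?b\<bar> * sv1 (M w) \<le> 2 * sv2 (M w)"
    using pos abs_mult_pos[of "sv1 (M w)" "gain A z w - ?b"]
    by (simp add: gain_def left_diff_distrib)
  then have 1: "\<bar>gain A z w - ?b\<bar> \<le> 2 * (sv2 (M w) / sv1 (M w))"
    using pos by (simp add: field_simps)
  have "sv1 (A i) \<le> 1"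
    using sv1_word_le[of "[i]"] i rho by simp
  then have "\<bar>norm (M (i # w) *v z) - ?b * sv1 (M (i # w))\<bar> \<le> 2 * sv2 (M w)"
    using relative_gain[OF s z, of "A i"] mult_right_mono[of "sv1 (A i)" 1 "sv2 (M w)"] by simp
  then have "\<bar>gain A z (i # w) - ?b\<bar> * sv1 (M (i # w)) \<le> 2 * sv2 (M w)"
    using pos' abs_mult_pos[of "sv1 (M (i # w))" "gain A z (i # w) - ?b"]
    by (simp add: gain_def left_diff_distrib)
  moreover have "\<kappa> * sv1 (M w) \<le> sv1 (M (i # w))"
  proof -
    have "\<kappa> * sv1 (M w) \<le> sv2 (A i) * sv1 (M w)"
      using sv2_word_ge[of "[i]"] i by (intro mult_right_mono) auto
    then show ?thesis using sv2_mult_sv1_le[of "A i" "M w"] by simp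
  qed
  ultimately have "\<bar>gain A z (i # w) - ?b\<bar> * (\<kappa> * sv1 (M w)) \<le> 2 * sv2 (M w)"
    using mult_left_mono[of "\<kappa> * sv1 (M w)" "sv1 (M (i # w))" "\<bar>gain A z (i # w) - ?b\<bar>"] by linarith
  then have 2: "\<bar>gain A z (i # w) - ?b\<bar> \<le> (2 / \<kappa>) * (sv2 (M w) / sv1 (M w))"
    using pos kappa by (simp add: field_simps)
  have "\<bar>gain A z (i # w) - gain A z w\<bar> \<le> (2 + 2 / \<kappa>) * (sv2 (M w) / sv1 (M w))"
    using 1 2 unfolding distrib_right by linarith
  also have "\<dots> \<le> (2 + 2 / \<kappa>) * (C * \<tau> ^ length w)"
    using dom kappa by (intro mult_left_mono) auto
  finally show ?thesis by simp
qed

text \<open>The one-letter errors form a geometric series whose largest term is determined by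
  \<open>length w\<close>, so the bound is uniform in the prefix \<open>i\<close>. The induction
  carries the finite geometric sum, since the limiting bound alone is not inductive.\<close>

lemma gain_append:
  assumes z: "norm z = 1" and w: "w \<in> W"
  shows "i \<in> W \<Longrightarrow> \<bar>gain A z (i @ w) - gain A z w\<bar> \<le> (2 + 2 / \<kappa>) * C * \<tau> ^ length w / (1 - \<tau>)"
proof -
  let ?K = "(2 + 2 / \<kappa>) * C"
  have K: "0 \<le> ?K" using kappa C by simp
  have "i \<in> W \<Longrightarrow> \<bar>gain A z (i @ w) - gain A z w\<bar> \<le> ?K * \<tau> ^ length w * (1 - \<tau> ^ length i) / (1 - \<tau>)"
  proof (induction i)
    case (Cons l i)
    have "\<bar>gain A z (l # (i @ w)) - gain A z (i @ w)\<bar> \<le> ?K * \<tau> ^ length (i @ w)"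
      using Cons.prems w by (intro gain_Cons z) auto
    moreover have "\<bar>gain A z (i @ w) - gain A z w\<bar> \<le> ?K * \<tau> ^ length w * (1 - \<tau> ^ length i) / (1 - \<tau>)"
      using Cons by simp
    moreover have "?K * \<tau> ^ length (i @ w) + ?K * \<tau> ^ length w * (1 - \<tau> ^ length i) / (1 - \<tau>)
       = ?K * \<tau> ^ length w * (1 - \<tau> ^ length (l # i)) / (1 - \<tau>)"
    proof -
      have "a * b * t + a * t * (1 - b) / (1 - \<tau>) = a * t * (1 - \<tau> * b) / (1 - \<tau>)" for a b t :: real
        using tau by (simp add: field_simps)
      from this[of ?K "\<tau> ^ length i" "\<tau> ^ length w"] show ?thesis
        by (simp only: length_append power_add length_Cons power_Suc mult.assoc)
    qed
    ultimately show ?case by simp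
  qed simp
  moreover have "?K * \<tau> ^ length w * (1 - \<tau> ^ length i) / (1 - \<tau>) \<le> ?K * \<tau> ^ length w / (1 - \<tau>)"
    using K tau by (intro divide_right_mono mult_left_le) auto
  ultimately show "i \<in> W \<Longrightarrow> ?thesis" by linarith
qed

lemma balanced_words_contradiction:
  assumes "K > 0" "\<And>n. \<exists>w\<in>W. n \<le> length w \<and> K * sv1 (M w) \<le> sv2 (M w)"
  shows False
proof -
  have "(\<lambda>n. C * \<tau> ^ n) \<longlonglongrightarrow> C * 0"
    using tau by (intro tendsto_mult_left LIMSEQ_realpow_zero) auto
  then have "\<forall>\<^sub>F n in sequentially. C * \<tau> ^ n < K"
    using assms(1) order_tendstoD(2)[of _ "C * 0" _ K] by simp
  then obtain n where n: "C * \<tau> ^ n < K" by (meson eventually_sequentially le_refl)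
  obtain w where w: "w \<in> W" "n \<le> length w" "K * sv1 (M w) \<le> sv2 (M w)" using assms(2) by blast
  have "\<tau> ^ length w \<le> \<tau> ^ n" using w(2) tau by (intro power_decreasing) auto
  then have "C * \<tau> ^ length w < K" using n C mult_left_mono[of "\<tau> ^ length w" "\<tau> ^ n" C] by linarith
  then have "C * \<tau> ^ length w * sv1 (M w) < K * sv1 (M w)"
    using sv1_word_pos[OF w(1)] by (intro mult_strict_right_mono)
  then show False using domination[OF w(1)] w(3) by linarith
qed

end

lemma unit_inner_separated:
  assumes "crossp u w \<noteq> 0"
  obtains \<theta> where "\<theta> > 0"
    "\<And>z. norm z = 1 \<Longrightarrow> \<theta> \<le> \<bar>u \<bullet> z\<bar> / norm u \<or> \<theta> \<le> \<bar>w \<bullet> z\<bar> / norm w"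
proof -
  obtain K where K: "K > 0" "\<And>z. norm z \<le> K * max \<bar>u \<bullet> z\<bar> \<bar>w \<bullet> z\<bar>"
    using norm_le_of_functionals[OF assms] by blast
  have nz: "u \<noteq> 0" "w \<noteq> 0" using assms by (auto simp: crossp_def)
  let ?\<theta> = "1 / (K * (norm u + norm w))"
  have "norm u + norm w > 0" using nz by (simp add: add_pos_pos)
  then have th: "?\<theta> > 0" using K by simp
  show ?thesis
  proof (rule that[OF th])
    fix z :: vec2 assume "norm z = 1"
    then have "1 / K \<le> max \<bar>u \<bullet> z\<bar> \<bar>w \<bullet> z\<bar>"
      using K(1) K(2)[of z] by (simp add: divide_le_eq mult.commute)
    moreover have "?\<theta> * norm u \<le> 1 / K" "?\<theta> * norm w \<le> 1 / K"
    proof -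
      have "1 / (K * s) * x \<le> 1 / K" if "0 \<le> x" "x \<le> s" "0 < s" for x s
        using that K(1) by (simp add: divide_simps)
      then show "?\<theta> * norm u \<le> 1 / K" "?\<theta> * norm w \<le> 1 / K"
        using \<open>norm u + norm w > 0\<close> by simp_all
    qed
    ultimately have "?\<theta> * norm u \<le> \<bar>u \<bullet> z\<bar> \<or> ?\<theta> * norm w \<le> \<bar>w \<bullet> z\<bar>"
      by linarith
    then show "?\<theta> \<le> \<bar>u \<bullet> z\<bar> / norm u \<or> ?\<theta> \<le> \<bar>w \<bullet> z\<bar> / norm w"
      using nz by (metis pos_le_divide_eq zero_less_norm_iff)
  qed
qed

context dominated_matrices
begin

text \<open>The suffix \<open>k\<close> is so long that any prefix changes its gain by at most
  \<open>\<theta> / 4\<close>, and so close to the limit that its own gain errs by at most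
  \<open>\<theta> / 4\<close>; thus \<open>\<theta> / 2\<close> remains. The factor
  \<open>sv2 (M k)\<close> in the constant passes from \<open>sv1 (M (i @ k))\<close> to
  \<open>sv1 (M i)\<close>.\<close>

lemma limit_row_suffix:
  assumes "limit_row N A u" "\<theta> > 0"
  obtains k c where "k \<in> W" "c > 0"
    "\<And>E i. \<lbrakk>norm E = 1; \<theta> \<le> \<bar>u \<bullet> E\<bar> / norm u; i \<in> W\<rbrakk> \<Longrightarrow> c * sv1 (M i) \<le> norm (M (i @ k) *v E)"
proof -
  let ?K = "(2 + 2 / \<kappa>) * C / (1 - \<tau>)"
  have K: "?K > 0" using kappa C tau by (simp add: add_pos_pos)
  obtain n where n: "\<tau> ^ n < \<theta> / (4 * ?K)"
    using real_arch_pow_inv[of "\<theta> / (4 * ?K)" \<tau>] tau K assms(2)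
    by (metis divide_pos_pos mult_pos_pos zero_less_numeral)
  obtain k where k: "k \<in> W" "n \<le> length k"
    and g: "\<And>z. norm z = 1 \<Longrightarrow> \<bar>gain A z k - \<bar>u \<bullet> z\<bar> / norm u\<bar> \<le> \<theta> / 4"
    using limit_row_gain[OF assms(1), of "\<theta> / 4" n] assms(2) by (metis zero_less_divide_iff zero_less_numeral)
  show ?thesis
  proof (rule that[OF k(1)])
    show "0 < \<theta> / 2 * sv2 (M k)" using assms(2) sv2_word_pos[OF k(1)] by simp
    fix E :: vec2 and i
    assume E: "norm E = 1" and th: "\<theta> \<le> \<bar>u \<bullet> E\<bar> / norm u" and i: "i \<in> W"
    have ik: "i @ k \<in> W" using i k by simp
    have "?K * \<tau> ^ length k \<le> ?K * \<tau> ^ n"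
      using k(2) tau K by (intro mult_left_mono power_decreasing) auto
    also have "\<dots> \<le> ?K * (\<theta> / (4 * ?K))"
      using n K by (intro mult_left_mono) auto
    also have "\<dots> = \<theta> / 4"
    proof -
      have "a * (\<theta> / (4 * a)) = \<theta> / 4" if "a > 0" for a using that by simp
      then show ?thesis using K by blast
    qed
    finally have "\<bar>gain A E (i @ k) - gain A E k\<bar> \<le> \<theta> / 4"
      using gain_append[OF E k(1) i] by simp
    then have "\<theta> / 2 \<le> gain A E (i @ k)" using g[OF E] th by linarith
    then have "\<theta> / 2 * sv1 (M (i @ k)) \<le> norm (M (i @ k) *v E)"
      using sv1_word_pos[OF ik] by (simp add: gain_def pos_le_divide_eq)
    moreover have "\<theta> / 2 * (sv1 (M i) * sv2 (M k)) \<le> \<theta> / 2 * sv1 (M (i @ k))"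
      using sv1_mult_sv2_le[of "M i" "M k"] assms(2)
      by (intro mult_left_mono) (simp_all add: word_mat_append)
    ultimately show "\<theta> / 2 * sv2 (M k) * sv1 (M i) \<le> norm (M (i @ k) *v E)"
      by (simp add: mult_ac)
  qed
qed

text \<open>Each of the two vectors is bad for at most one of the three rows.\<close>
lemma good_suffix:
  assumes row: "limit_row N A u1" "limit_row N A u2" "limit_row N A u3"
    and cross: "crossp u1 u2 \<noteq> 0" "crossp u1 u3 \<noteq> 0" "crossp u2 u3 \<noteq> 0"
  obtains c where "0 < c" "c \<le> 1"
    "\<And>E F. \<exists>k\<in>W. \<forall>i\<in>W. c * sv1 (M i) * norm E \<le> norm (M (i @ k) *v E) \<and>
       c * sv1 (M i) * norm F \<le> norm (M (i @ k) *v F)"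
proof -
  let ?f = "\<lambda>u z. \<bar>u \<bullet> z\<bar> / norm u"
  obtain a where a: "a > 0" "\<And>z. norm z = 1 \<Longrightarrow> a \<le> ?f u1 z \<or> a \<le> ?f u2 z"
    using unit_inner_separated[OF cross(1)] by blast
  obtain b where b: "b > 0" "\<And>z. norm z = 1 \<Longrightarrow> b \<le> ?f u1 z \<or> b \<le> ?f u3 z"
    using unit_inner_separated[OF cross(2)] by blast
  obtain d where d: "d > 0" "\<And>z. norm z = 1 \<Longrightarrow> d \<le> ?f u2 z \<or> d \<le> ?f u3 z"
    using unit_inner_separated[OF cross(3)] by blast
  define \<theta> where "\<theta> = min a (min b d)"
  have th: "\<theta> > 0" "\<theta> \<le> a" "\<theta> \<le> b" "\<theta> \<le> d" using a b d by (auto simp: \<theta>_def)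
  obtain k1 c1 where k1: "k1 \<in> W" "c1 > 0"
    "\<And>E i. \<lbrakk>norm E = 1; \<theta> \<le> ?f u1 E; i \<in> W\<rbrakk> \<Longrightarrow> c1 * sv1 (M i) \<le> norm (M (i @ k1) *v E)"
    using limit_row_suffix[OF row(1) th(1)] by blast
  obtain k2 c2 where k2: "k2 \<in> W" "c2 > 0"
    "\<And>E i. \<lbrakk>norm E = 1; \<theta> \<le> ?f u2 E; i \<in> W\<rbrakk> \<Longrightarrow> c2 * sv1 (M i) \<le> norm (M (i @ k2) *v E)"
    using limit_row_suffix[OF row(2) th(1)] by blast
  obtain k3 c3 where k3: "k3 \<in> W" "c3 > 0"
    "\<And>E i. \<lbrakk>norm E = 1; \<theta> \<le> ?f u3 E; i \<in> W\<rbrakk> \<Longrightarrow> c3 * sv1 (M i) \<le> norm (M (i @ k3) *v E)"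
    using limit_row_suffix[OF row(3) th(1)] by blast
  define c where "c = min 1 (min c1 (min c2 c3))"
  have c: "0 < c" "c \<le> 1" "c \<le> c1" "c \<le> c2" "c \<le> c3"
    using k1 k2 k3 by (auto simp: c_def)
  have mono: "c * sv1 (M i) \<le> x" if "c' * sv1 (M i) \<le> x" "c \<le> c'" for c' x i
    using order_trans[OF mult_right_mono[OF that(2) sv1_nonneg] that(1)] .
  have "\<exists>k\<in>W. \<forall>i\<in>W. c * sv1 (M i) \<le> norm (M (i @ k) *v E) \<and> c * sv1 (M i) \<le> norm (M (i @ k) *v F)"
    if EF: "norm E = 1" "norm F = 1" for E F
  proof -
    have "(\<theta> \<le> ?f u1 E \<and> \<theta> \<le> ?f u1 F) \<or> (\<theta> \<le> ?f u2 E \<and> \<theta> \<le> ?f u2 F)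
        \<or> (\<theta> \<le> ?f u3 E \<and> \<theta> \<le> ?f u3 F)"
      using a(2)[OF EF(1)] b(2)[OF EF(1)] d(2)[OF EF(1)]
        a(2)[OF EF(2)] b(2)[OF EF(2)] d(2)[OF EF(2)] th(2-4) by argo
    then show ?thesis
    proof (elim disjE conjE)
      assume "\<theta> \<le> ?f u1 E" "\<theta> \<le> ?f u1 F"
      then show ?thesis using k1 EF mono[OF _ c(3)] by (intro bexI[of _ k1]) auto
    next
      assume "\<theta> \<le> ?f u2 E" "\<theta> \<le> ?f u2 F"
      then show ?thesis using k2 EF mono[OF _ c(4)] by (intro bexI[of _ k2]) auto
    next
      assume "\<theta> \<le> ?f u3 E" "\<theta> \<le> ?f u3 F"
      then show ?thesis using k3 EF mono[OF _ c(5)] by (intro bexI[of _ k3]) auto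
    qed
  qed
  note unit = this
  \<comment> \<open>For a zero vector the required inequality is trivial, so an arbitrary unit
    vector stands in for it.\<close>
  have scale: "c * sv1 L * norm E \<le> norm (P *v E)"
    if "c * sv1 L \<le> norm (P *v (if E = 0 then axis 1 1 else E /\<^sub>R norm E))" for E L and P :: mat2
  proof (cases "E = 0")
    case False
    then have "c * sv1 L \<le> norm (P *v E) / norm E"
      using that by (simp add: matrix_vector_mult_scaleR divide_inverse mult.commute)
    then show ?thesis using False by (simp add: pos_le_divide_eq)
  qed simp
  show ?thesis
  proof (rule that[OF c(1,2)])
    fix E F :: vec2
    let ?n = "\<lambda>E::vec2. if E = 0 then axis 1 1 else E /\<^sub>R norm E"
    have "norm (?n E) = 1" for E by simp
    then obtain k where "k \<in> W" "\<forall>i\<in>W. c * sv1 (M i) \<le> norm (M (i @ k) *v ?n E) \<and> c * sv1 (M i) \<le> norm (M (i @ k) *v ?n F)"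
      using unit[of "?n E" "?n F"] by blast
    then show "\<exists>k\<in>W. \<forall>i\<in>W. c * sv1 (M i) * norm E \<le> norm (M (i @ k) *v E) \<and>
       c * sv1 (M i) * norm F \<le> norm (M (i @ k) *v F)"
      using scale by (intro bexI[of _ k]) auto
  qed
qed

section \<open>Excluding exactly two lines of limit rows\<close>

lemma diagonal_word:
  assumes u: "crossp u1 u2 \<noteq> 0"
  obtains K where "K > 0"
    "\<forall>w\<in>W. \<forall>p q Y. (\<forall>z. \<bar>u1 \<bullet> (M w *v z)\<bar> = p * \<bar>u1 \<bullet> z\<bar>) \<and> (\<forall>z. \<bar>u2 \<bullet> (M w *v z)\<bar> = q * \<bar>u2 \<bullet> z\<bar>) \<and>
       p \<le> Y * q \<and> q \<le> Y * p \<and> 1 \<le> Y \<longrightarrow> K * sv1 (M w) \<le> Y * sv2 (M w)"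
proof -
  obtain K where K: "K > 0" "\<And>z. norm z \<le> K * max \<bar>u1 \<bullet> z\<bar> \<bar>u2 \<bullet> z\<bar>"
    using norm_le_of_functionals[OF u] by blast
  let ?U = "norm u1 + norm u2"
  have U: "max \<bar>u1 \<bullet> z\<bar> \<bar>u2 \<bullet> z\<bar> \<le> ?U * norm z" for z
  proof -
    have "\<bar>u1 \<bullet> z\<bar> \<le> norm u1 * norm z" "\<bar>u2 \<bullet> z\<bar> \<le> norm u2 * norm z"
      by (rule Cauchy_Schwarz_ineq2)+
    moreover have "0 \<le> norm u1 * norm z" "0 \<le> norm u2 * norm z" by simp_all
    ultimately show ?thesis by (simp add: distrib_right add_increasing add_increasing2)
  qed
  have "u1 \<noteq> 0" using u by (auto simp: crossp_def)
  then have Upos: "?U > 0" by (simp add: add_pos_nonneg)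
  show ?thesis
  proof (rule that[of "1 / (K * ?U) ^ 2"])
    show "1 / (K * ?U) ^ 2 > 0" using K Upos by simp
    show "\<forall>w\<in>W. \<forall>p q Y. (\<forall>z. \<bar>u1 \<bullet> (M w *v z)\<bar> = p * \<bar>u1 \<bullet> z\<bar>) \<and> (\<forall>z. \<bar>u2 \<bullet> (M w *v z)\<bar> = q * \<bar>u2 \<bullet> z\<bar>) \<and>
       p \<le> Y * q \<and> q \<le> Y * p \<and> 1 \<le> Y \<longrightarrow> 1 / (K * ?U) ^ 2 * sv1 (M w) \<le> Y * sv2 (M w)"
    proof (intro ballI allI impI, elim conjE)
      fix w p q Y assume w: "w \<in> W" and p: "\<forall>z. \<bar>u1 \<bullet> (M w *v z)\<bar> = p * \<bar>u1 \<bullet> z\<bar>"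
        and q: "\<forall>z. \<bar>u2 \<bullet> (M w *v z)\<bar> = q * \<bar>u2 \<bullet> z\<bar>" and Y: "p \<le> Y * q" "q \<le> Y * p" "1 \<le> Y"
      let ?m = "\<lambda>z. max \<bar>u1 \<bullet> z\<bar> \<bar>u2 \<bullet> z\<bar>"
      have pq: "p \<ge> 0" "q \<ge> 0"
      proof -
        obtain z where "u1 \<bullet> z = 1" using dual_vector[OF u] by blast
        then show "p \<ge> 0" using spec[OF p, of z] by (metis abs_ge_zero abs_one mult.right_neutral)
        obtain z where "u2 \<bullet> z = 1" using dual_vector[of u2 u1] u
          by (metis crossp_commute neg_equal_0_iff_equal)
        then show "q \<ge> 0" using spec[OF q, of z] by (metis abs_ge_zero abs_one mult.right_neutral)
      qed
      \<comment> \<open>In the coordinates given by \<open>u1\<close> and \<open>u2\<close> the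
        matrix is diagonal up to signs, with factors \<open>p\<close> and \<open>q\<close>. The
        change of coordinates costs \<open>K * ?U\<close> once for \<open>sv1\<close> and once for
        \<open>sv2\<close>, hence the square in the constant.\<close>
      have up: "sv1 (M w) \<le> K * ?U * max p q"
      proof (rule sv1_le)
        fix z
        have "?m (M w *v z) \<le> max p q * ?m z"
          unfolding p[rule_format] q[rule_format] using pq by (intro max.boundedI mult_mono) auto
        also have "\<dots> \<le> max p q * (?U * norm z)"
          using pq U[of z] by (intro mult_left_mono) auto
        finally have "K * ?m (M w *v z) \<le> K * (max p q * (?U * norm z))"
          using K by simp
        then show "norm (M w *v z) \<le> K * ?U * max p q * norm z"
          using K(2)[of "M w *v z"] by (simp add: mult_ac)
      qed
      have lo: "min p q \<le> K * ?U * sv2 (M w)"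
      proof -
        obtain z where z: "norm z = 1" "norm (M w *v z) = sv2 (M w)" by (rule sv2_attained)
        have "min p q * 1 \<le> min p q * (K * ?m z)"
          using K(2)[of z] z pq by (intro mult_left_mono) auto
        also have "\<dots> = K * (min p q * ?m z)" by simp
        also have "min p q * ?m z \<le> ?m (M w *v z)"
          unfolding p[rule_format] q[rule_format]
          using mult_right_mono[of "min p q" p "\<bar>u1 \<bullet> z\<bar>"] mult_right_mono[of "min p q" q "\<bar>u2 \<bullet> z\<bar>"]
          by (auto simp: max_def)
        also have "?m (M w *v z) \<le> ?U * sv2 (M w)" using U[of "M w *v z"] z by simp
        finally show ?thesis using K by (simp add: mult_ac)
      qed
      have "max p q \<le> Y * min p q"
        using Y pq mult_right_mono[of 1 Y p] mult_right_mono[of 1 Y q] by (auto simp: max_def min_def)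
      also have "\<dots> \<le> Y * (K * ?U * sv2 (M w))"
        using lo Y by (intro mult_left_mono) auto
      finally have Y2: "max p q \<le> Y * (K * ?U * sv2 (M w))" .
      have KU: "K * ?U > 0" using K Upos by simp
      have "sv1 (M w) \<le> K * ?U * (Y * (K * ?U * sv2 (M w)))"
        using up mult_left_mono[OF Y2, of "K * ?U"] KU by linarith
      moreover have "1 / g ^ 2 * s \<le> y * x" if "s \<le> g * (y * (g * x))" "0 < g" for g s x y :: real
        using that by (simp add: pos_divide_le_eq power2_eq_square mult_ac)
      ultimately show "1 / (K * ?U) ^ 2 * sv1 (M w) \<le> Y * sv2 (M w)"
        using KU by blast
    qed
  qed
qed

end

lemma power_bracket:
  assumes "1 \<le> (x::real)" "1 < b"
  obtains m where "b ^ m \<le> x" "x < b ^ Suc m"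
proof -
  obtain k where k: "x < b ^ k" using real_arch_pow[OF assms(2)] by blast
  define n where "n = (LEAST n. x < b ^ n)"
  have n: "x < b ^ n" unfolding n_def by (rule LeastI[of "\<lambda>n. x < b ^ n", OF k])
  moreover have "n \<noteq> 0" using n assms by (intro notI) simp
  then obtain m where m: "n = Suc m" using not0_implies_Suc by blast
  moreover have "\<not> x < b ^ m" using not_less_Least[of m "\<lambda>n. x < b ^ n"] m n_def by simp
  ultimately show ?thesis using that[of m] by simp
qed

context contracting_matrices
begin

text \<open>If the factor for \<open>u2\<close> were at least as large in modulus for every letter,
  it would be so for every word. In the limit towards a matrix with row \<open>u1\<close> the scaled
  factor for \<open>u2\<close> tends to 0, hence so does the one for \<open>u1\<close>. This makes
  the column \<open>e\<close> orthogonal to \<open>u1\<close>; it is orthogonal to \<open>u2\<close>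
  anyway, so it would vanish.\<close>

lemma limit_row_dominant_letter:
  assumes row: "limit_row N A u1" and cross: "crossp u1 u2 \<noteq> 0"
    and p: "\<And>i z. i < N \<Longrightarrow> u1 \<bullet> (A i *v z) = p i * (u1 \<bullet> z)"
    and q: "\<And>i z. i < N \<Longrightarrow> u2 \<bullet> (A i *v z) = q i * (u2 \<bullet> z)"
  shows "\<exists>i<N. \<bar>q i\<bar> < \<bar>p i\<bar>"
proof (rule ccontr)
  assume "\<not> ?thesis"
  then have le: "\<bar>p i\<bar> \<le> \<bar>q i\<bar>" if "i < N" for i using that by force
  have word: "w \<in> W \<Longrightarrow> \<exists>a b. (\<forall>z. u1 \<bullet> (M w *v z) = a * (u1 \<bullet> z) \<and> u2 \<bullet> (M w *v z) = b * (u2 \<bullet> z)) \<and> \<bar>a\<bar> \<le> \<bar>b\<bar>"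
    for w
  proof (induction w)
    case Nil
    show ?case by (rule exI[of _ 1], rule exI[of _ 1]) simp
  next
    case (Cons i w)
    then obtain a b where ab: "\<And>z. u1 \<bullet> (M w *v z) = a * (u1 \<bullet> z)"
      "\<And>z. u2 \<bullet> (M w *v z) = b * (u2 \<bullet> z)" "\<bar>a\<bar> \<le> \<bar>b\<bar>" by auto
    have "\<bar>p i * a\<bar> \<le> \<bar>q i * b\<bar>" unfolding abs_mult
      using le[of i] Cons.prems ab by (intro mult_mono) auto
    moreover have "u1 \<bullet> (M (i # w) *v z) = p i * a * (u1 \<bullet> z)"
      "u2 \<bullet> (M (i # w) *v z) = q i * b * (u2 \<bullet> z)" for z
      using Cons.prems ab p q by (simp_all add: matrix_vector_mul_assoc[symmetric])
    ultimately show ?case by blast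
  qed
  obtain e where e: "e \<noteq> 0" and
    lim: "\<And>\<epsilon>. \<epsilon> > 0 \<Longrightarrow> \<exists>w\<in>W. \<exists>c. \<forall>z. norm (c *\<^sub>R (M w *v z) - (u1 \<bullet> z) *\<^sub>R e) \<le> \<epsilon> * norm z"
    using row unfolding limit_row_def by blast
  obtain z2 where z2: "u1 \<bullet> z2 = 1" "u2 \<bullet> z2 = 0" using dual_vector[OF cross] by blast
  obtain z1 where z1: "u2 \<bullet> z1 = 1" "u1 \<bullet> z1 = 0"
    using dual_vector[of u2 u1] cross by (metis crossp_commute neg_equal_0_iff_equal)
  have bound: "\<bar>u2 \<bullet> e\<bar> \<le> \<epsilon> * (norm u2 * norm z2) \<and>
      \<bar>u1 \<bullet> e\<bar> \<le> \<epsilon> * (norm u1 * norm z2 + norm u2 * norm z1)" if "\<epsilon> > 0" for \<epsilon>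
  proof -
    obtain w c where w: "w \<in> W" and
      ap: "\<And>z. norm (c *\<^sub>R (M w *v z) - (u1 \<bullet> z) *\<^sub>R e) \<le> \<epsilon> * norm z"
      using lim[OF \<open>\<epsilon> > 0\<close>] by blast
    obtain a b where ab: "\<And>z. u1 \<bullet> (M w *v z) = a * (u1 \<bullet> z)"
      "\<And>z. u2 \<bullet> (M w *v z) = b * (u2 \<bullet> z)" "\<bar>a\<bar> \<le> \<bar>b\<bar>" using word[OF w] by blast
    have ap': "\<bar>c * (u \<bullet> (M w *v z)) - (u1 \<bullet> z) * (u \<bullet> e)\<bar> \<le> \<epsilon> * (norm u * norm z)" for u z
    proof -
      have "\<bar>u \<bullet> (c *\<^sub>R (M w *v z) - (u1 \<bullet> z) *\<^sub>R e)\<bar> \<le> norm u * (\<epsilon> * norm z)"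
        by (rule order_trans[OF Cauchy_Schwarz_ineq2]) (intro mult_left_mono ap norm_ge_zero)
      then show ?thesis by (simp add: inner_diff_right mult_ac)
    qed
    have 1: "\<bar>u2 \<bullet> e\<bar> \<le> \<epsilon> * (norm u2 * norm z2)" using ap'[of u2 z2] z2 ab by simp
    have 2: "\<bar>c * b\<bar> \<le> \<epsilon> * (norm u2 * norm z1)" using ap'[of u2 z1] z1 ab by simp
    have 3: "\<bar>c * a - u1 \<bullet> e\<bar> \<le> \<epsilon> * (norm u1 * norm z2)" using ap'[of u1 z2] z2 ab by simp
    have "\<bar>c * a\<bar> \<le> \<bar>c * b\<bar>" using ab(3) by (simp add: abs_mult mult_left_mono)
    then have "\<bar>u1 \<bullet> e\<bar> \<le> \<epsilon> * (norm u1 * norm z2) + \<epsilon> * (norm u2 * norm z1)" using 2 3 by linarith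
    then show ?thesis using 1 by (simp add: distrib_left)
  qed
  have zero: "x = 0" if "\<And>\<epsilon>. \<epsilon> > 0 \<Longrightarrow> \<bar>x\<bar> \<le> \<epsilon> * k" "k \<ge> 0" for x k :: real
  proof (rule ccontr)
    assume "x \<noteq> 0"
    then have "\<bar>x\<bar> > 0" by simp
    then have "\<bar>x\<bar> \<le> \<bar>x\<bar> / (k + 1) * k" using that(1)[of "\<bar>x\<bar> / (k + 1)"] that(2) by simp
    then have "\<bar>x\<bar> * (k + 1) \<le> \<bar>x\<bar> * k" using that(2) by (simp add: field_simps)
    then show False using \<open>\<bar>x\<bar> > 0\<close> by simp
  qed
  have "u2 \<bullet> e = 0" by (rule zero[of _ "norm u2 * norm z2"]) (use bound in auto)
  moreover have "u1 \<bullet> e = 0"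
    by (rule zero[of _ "norm u1 * norm z2 + norm u2 * norm z1"]) (use bound in auto)
  moreover obtain K where "\<And>z. norm z \<le> K * max \<bar>u1 \<bullet> z\<bar> \<bar>u2 \<bullet> z\<bar>"
    using norm_le_of_functionals[OF cross] by blast
  ultimately have "norm e \<le> 0" by (metis abs_zero max.idem mult_zero_right)
  then show False using e by simp
qed

end

context dominated_matrices
begin

text \<open>If the limit rows lay on two lines only, the matrices would permute these lines. A swap has a
  scalar square, and if there is no swap then powers of two letters can be balanced; both contradict
  domination.\<close>
lemma third_limit_row:
  assumes row: "limit_row N A u1" "limit_row N A u2" and cross: "crossp u1 u2 \<noteq> 0"
  obtains u3 where "limit_row N A u3" "crossp u1 u3 \<noteq> 0" "crossp u2 u3 \<noteq> 0"
proof (rule ccontr)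
  assume no: "\<not> thesis"
  note third = that
  have two: "crossp u1 u = 0 \<or> crossp u2 u = 0" if "limit_row N A u" for u
    using third[OF that] no by blast
  have nz: "u1 \<noteq> 0" "u2 \<noteq> 0" using row by (auto simp: limit_row_def)
  have cross': "crossp u2 u1 \<noteq> 0" using cross crossp_commute[of u1 u2] by simp
  obtain K where K0: "K > 0"
    and Kle: "\<forall>w\<in>W. \<forall>p q Y. (\<forall>z. \<bar>u1 \<bullet> (M w *v z)\<bar> = p * \<bar>u1 \<bullet> z\<bar>) \<and>
       (\<forall>z. \<bar>u2 \<bullet> (M w *v z)\<bar> = q * \<bar>u2 \<bullet> z\<bar>) \<and> p \<le> Y * q \<and> q \<le> Y * p \<and> 1 \<le> Y \<longrightarrow>
       K * sv1 (M w) \<le> Y * sv2 (M w)"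
    using diagonal_word[OF cross] by blast
  have K: "K * sv1 (M w) \<le> Y * sv2 (M w)"
    if "w \<in> W" "\<And>z. \<bar>u1 \<bullet> (M w *v z)\<bar> = p * \<bar>u1 \<bullet> z\<bar>" "\<And>z. \<bar>u2 \<bullet> (M w *v z)\<bar> = q * \<bar>u2 \<bullet> z\<bar>"
      "p \<le> Y * q" "q \<le> Y * p" "1 \<le> Y" for w p q Y
    using Kle that by blast
  have par: "(\<exists>l. l \<noteq> 0 \<and> (\<forall>z. u \<bullet> (A i *v z) = l * (u1 \<bullet> z))) \<or> (\<exists>l. l \<noteq> 0 \<and> (\<forall>z. u \<bullet> (A i *v z) = l * (u2 \<bullet> z)))"
    if "limit_row N A u" "i < N" for u i
  proof -
    let ?t = "u v* A i"
    have t: "limit_row N A ?t" using limit_row_letter[OF that] .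
    then have tnz: "?t \<noteq> 0" by (simp add: limit_row_def)
    have "\<exists>l. l \<noteq> 0 \<and> (\<forall>z. u \<bullet> (A i *v z) = l * (y \<bullet> z))" if y: "crossp y ?t = 0" "y \<noteq> 0" for y
    proof -
      obtain l where l: "?t = l *\<^sub>R y" using crossp_eq_0_imp_parallel[OF y] by blast
      then have "u \<bullet> (A i *v z) = l * (y \<bullet> z)" for z
        using dot_lmul_matrix[of u "A i" z] by simp
      then show ?thesis using l tnz by (intro exI[of _ l]) auto
    qed
    then show ?thesis using two[OF t] nz by blast
  qed
  have indep: False if il: "i < N" "\<And>z. u1 \<bullet> (A i *v z) = l * (y \<bullet> z)" "\<And>z. u2 \<bullet> (A i *v z) = m * (y \<bullet> z)"
    "l \<noteq> 0" for i l m y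
  proof -
    obtain z where z: "u1 \<bullet> z = 0" "u2 \<bullet> z = 1" using dual_vector[OF cross'] by blast
    obtain x where "A i *v x = z" using letter_surj[OF il(1)] by blast
    then show False using il(2)[of x] il(3)[of x] il(4) z by simp
  qed
  \<comment> \<open>\<open>R i u y\<close> says that \<open>A i\<close> carries the row
    \<open>u\<close> to a nonzero multiple of \<open>y\<close>. As \<open>A i\<close> is surjective,
    two independent rows cannot land on one line, so a letter either fixes both lines or swaps
    them.\<close>
  define R where "R i u y \<longleftrightarrow> (\<exists>l. l \<noteq> 0 \<and> (\<forall>z. u \<bullet> (A i *v z) = l * (y \<bullet> z)))" for i u y
  have diag: "R i u1 u1 \<and> R i u2 u2" if i: "i < N" for i
  proof (rule ccontr)
    assume "\<not> ?thesis"
    moreover have "R i u1 u1 \<or> R i u1 u2" "R i u2 u1 \<or> R i u2 u2"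
      using par[OF row(1) i] par[OF row(2) i] by (simp_all add: R_def)
    moreover have "\<not> (R i u1 y \<and> R i u2 y)" for y
      unfolding R_def using indep[OF i] by blast
    ultimately have "R i u1 u2" "R i u2 u1" by blast+
    then obtain l m where l: "\<And>z. u1 \<bullet> (A i *v z) = l * (u2 \<bullet> z)"
      and m: "\<And>z. u2 \<bullet> (A i *v z) = m * (u1 \<bullet> z)"
      unfolding R_def by blast
    have "replicate (2 * n) i \<in> W \<and>
        (\<forall>z. u1 \<bullet> (M (replicate (2 * n) i) *v z) = (l * m) ^ n * (u1 \<bullet> z)
           \<and> u2 \<bullet> (M (replicate (2 * n) i) *v z) = (l * m) ^ n * (u2 \<bullet> z))" for n
      by (induction n) (use i l m in \<open>simp_all add: matrix_vector_mul_assoc[symmetric]\<close>)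
    then have "K * sv1 (M (replicate (2 * n) i)) \<le> 1 * sv2 (M (replicate (2 * n) i))" for n
      by (intro K[where p = "\<bar>l * m\<bar> ^ n" and q = "\<bar>l * m\<bar> ^ n"]) (auto simp: abs_mult power_abs)
    then have "\<exists>w\<in>W. n \<le> length w \<and> K * sv1 (M w) \<le> sv2 (M w)" for n
      using i by (intro bexI[of _ "replicate (2 * n) i"]) auto
    then show False using balanced_words_contradiction[OF K0] by blast
  qed
  obtain p q where pq: "\<And>i. i < N \<Longrightarrow> p i \<noteq> 0" "\<And>i. i < N \<Longrightarrow> q i \<noteq> 0"
    and p: "\<And>i z. i < N \<Longrightarrow> u1 \<bullet> (A i *v z) = p i * (u1 \<bullet> z)"
    and q: "\<And>i z. i < N \<Longrightarrow> u2 \<bullet> (A i *v z) = q i * (u2 \<bullet> z)"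
  proof -
    have "\<forall>i. \<exists>l. i < N \<longrightarrow> l \<noteq> 0 \<and> (\<forall>z. u1 \<bullet> (A i *v z) = l * (u1 \<bullet> z))"
      "\<forall>i. \<exists>l. i < N \<longrightarrow> l \<noteq> 0 \<and> (\<forall>z. u2 \<bullet> (A i *v z) = l * (u2 \<bullet> z))"
      using diag unfolding R_def by blast+
    then show ?thesis using that unfolding choice_iff by blast
  qed
  obtain i where i: "i < N" "\<bar>q i\<bar> < \<bar>p i\<bar>"
    using limit_row_dominant_letter[OF row(1) cross p q] by blast
  obtain j where j: "j < N" "\<bar>p j\<bar> < \<bar>q j\<bar>"
    using limit_row_dominant_letter[OF row(2) cross' q p] by blast
  define a where "a = \<bar>p i\<bar> / \<bar>q i\<bar>"
  define b where "b = \<bar>q j\<bar> / \<bar>p j\<bar>"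
  have a: "1 < a" using i pq(2)[of i] by (simp add: a_def)
  have b: "1 < b" using j pq(1)[of j] by (simp add: b_def)
  have pw: "u1 \<bullet> (M (replicate n i) *v z) = p i ^ n * (u1 \<bullet> z)"
    "u2 \<bullet> (M (replicate n i) *v z) = q i ^ n * (u2 \<bullet> z)" if "i < N" for i n z
    by (induction n) (use p q that in \<open>simp_all add: matrix_vector_mul_assoc[symmetric]\<close>)
  have "\<exists>w\<in>W. n \<le> length w \<and> K / b * sv1 (M w) \<le> sv2 (M w)" for n
  proof -
    \<comment> \<open>The factors of \<open>?w\<close> have ratio \<open>a ^ n / b ^ m\<close>,
      which this \<open>m\<close> places between 1 and \<open>b\<close>; hence \<open>Y = b\<close>
      serves for all \<open>n\<close>.\<close>
    obtain m where m: "b ^ m \<le> a ^ n" "a ^ n < b ^ Suc m"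
      using power_bracket[of "a ^ n" b] a b by (metis less_imp_le one_le_power)
    let ?w = "replicate n i @ replicate m j"
    let ?P = "\<bar>p i\<bar> ^ n * \<bar>p j\<bar> ^ m" and ?Q = "\<bar>q i\<bar> ^ n * \<bar>q j\<bar> ^ m"
    have w: "?w \<in> W" using i j by auto
    have pos: "\<bar>q i\<bar> ^ n * \<bar>p j\<bar> ^ m > 0" using pq i j by simp
    have P: "?P = a ^ n * (\<bar>q i\<bar> ^ n * \<bar>p j\<bar> ^ m)"
      using pq(2)[OF i(1)] by (simp add: a_def power_divide)
    have Q: "?Q = b ^ m * (\<bar>q i\<bar> ^ n * \<bar>p j\<bar> ^ m)"
      using pq(1)[OF j(1)] by (simp add: b_def power_divide)
    have QP: "?Q \<le> ?P" unfolding P Q using m(1) pos by (intro mult_right_mono) auto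
    have PQ: "?P \<le> b * ?Q"
    proof -
      have "a ^ n * (\<bar>q i\<bar> ^ n * \<bar>p j\<bar> ^ m) \<le> b ^ Suc m * (\<bar>q i\<bar> ^ n * \<bar>p j\<bar> ^ m)"
        using m(2) pos by (intro mult_right_mono) auto
      then show ?thesis unfolding P Q by (simp add: mult.assoc)
    qed
    have "K * sv1 (M ?w) \<le> b * sv2 (M ?w)"
    proof (rule K[OF w])
      show "\<bar>u1 \<bullet> (M ?w *v z)\<bar> = ?P * \<bar>u1 \<bullet> z\<bar>" "\<bar>u2 \<bullet> (M ?w *v z)\<bar> = ?Q * \<bar>u2 \<bullet> z\<bar>" for z
        using pw[OF i(1)] pw[OF j(1)]
        by (simp_all add: word_mat_append matrix_vector_mul_assoc[symmetric] abs_mult power_abs)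
      show "?Q \<le> b * ?P" using QP b pq i j mult_mono[of 1 b ?Q ?P] by simp
    qed (use PQ b in auto)
    then have "K / b * sv1 (M ?w) \<le> sv2 (M ?w)" using b by (simp add: divide_le_eq mult.commute)
    then show ?thesis using w by (intro bexI[of _ ?w]) auto
  qed
  moreover have "K / b > 0" using K0 b by simp
  ultimately show False using balanced_words_contradiction by blast
qed

end

section \<open>Furstenberg directions and small displacements\<close>

text \<open>The adjugate of \<open>B\<close> applied to \<open>z\<close>. In the plane it is linear
  in \<open>B\<close>, so unlike inversion it passes to the singular limits that define the
  Furstenberg directions.\<close>

definition adjugate_mult :: "mat2 \<Rightarrow> vec2 \<Rightarrow> vec2" where
  "adjugate_mult B z = vector [B $ 2 $ 2 * z $ 1 - B $ 1 $ 2 * z $ 2, B $ 1 $ 1 * z $ 2 - B $ 2 $ 1 * z $ 1]"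

lemma matrix_mult_component:
  "((B::mat2) *v z) $ i = B $ i $ 1 * z $ 1 + B $ i $ 2 * z $ 2"
  by (simp add: matrix_vector_mult_def sum_2)

lemma adjugate_mult_matrix: "adjugate_mult B (B *v z) = det B *\<^sub>R z"
  by (simp add: adjugate_mult_def vec_eq_iff forall_2 matrix_mult_component det_2 algebra_simps)

lemma adjugate_mult_diff: "adjugate_mult (B - L) z = adjugate_mult B z - adjugate_mult L z"
  by (simp add: adjugate_mult_def vec_eq_iff forall_2 algebra_simps)

lemma adjugate_mult_scaleR: "adjugate_mult (c *\<^sub>R B) z = c *\<^sub>R adjugate_mult B z"
  by (simp add: adjugate_mult_def vec_eq_iff forall_2 algebra_simps)

lemma norm_adjugate_mult_le: "norm (adjugate_mult B z) \<le> 4 * (norm B * norm z)"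
proof -
  have "\<bar>B $ i $ j\<bar> * \<bar>z $ k\<bar> \<le> norm B * norm z" for i j k
  proof (rule mult_mono)
    show "\<bar>B $ i $ j\<bar> \<le> norm B"
      using component_le_norm_cart[of "B $ i" j] Finite_Cartesian_Product.norm_nth_le[of B i] by linarith
    show "\<bar>z $ k\<bar> \<le> norm z" by (rule component_le_norm_cart)
  qed auto
  then have le: "\<bar>B $ i $ j * z $ k\<bar> \<le> norm B * norm z" for i j k by (simp add: abs_mult)
  have "norm (adjugate_mult B z) \<le> \<bar>adjugate_mult B z $ 1\<bar> + \<bar>adjugate_mult B z $ 2\<bar>"
    using norm_le_l1_cart[of "adjugate_mult B z"] by (simp add: sum_2)
  also have "\<dots> \<le> 4 * (norm B * norm z)"
    using le[of 2 2 1] le[of 1 2 2] le[of 1 1 2] le[of 2 1 1]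
    by (simp add: adjugate_mult_def)
  finally show ?thesis .
qed

text \<open>Both rows of the adjugate are orthogonal to both columns of \<open>B\<close>, hence
  parallel. The vector \<open>u\<close> is a nonzero one among them and \<open>e\<close> records
  their multiples of \<open>u\<close>; the case distinction is whether the first row
  vanishes.\<close>

lemma rank_one_adjugate:
  fixes B :: mat2
  assumes "rank B = 1"
  obtains u e where "u \<noteq> 0" "e \<noteq> 0" "range (\<lambda>x. B *v x) = {z. u \<bullet> z = 0}"
    "\<And>z. adjugate_mult B z = (u \<bullet> z) *\<^sub>R e"
proof -
  let ?a = "B $ 1 $ 1" and ?b = "B $ 1 $ 2" and ?c = "B $ 2 $ 1" and ?d = "B $ 2 $ 2"
  have det: "?a * ?d = ?b * ?c"
    using det_eq_0_rank[of B] assms by (simp add: det_2)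
  have "B \<noteq> 0" using assms by auto
  show ?thesis
  proof (cases "?d = 0 \<and> ?b = 0")
    case False
    let ?u = "vector [?d, - ?b] :: vec2" and ?p = "vector [?b, ?d] :: vec2"
    have u: "?u \<noteq> 0" "?p \<noteq> 0" using False by (auto simp: vec_eq_iff forall_2)
    have "crossp ?u (vector [- ?c, ?a]) = 0" using det by (simp add: crossp_def mult_ac)
    then obtain l where l: "vector [- ?c, ?a] = l *\<^sub>R ?u" using crossp_eq_0_imp_parallel u by metis
    then have l': "- ?c = l * ?d" "?a = - l * ?b"
      by (simp_all add: vec_eq_iff forall_2)
    show ?thesis
    proof (rule that[of ?u "vector [1, l]"])
      show "(vector [1, l] :: vec2) \<noteq> 0" by (simp add: vec_eq_iff forall_2)
      show "range (\<lambda>x. B *v x) = {z. ?u \<bullet> z = 0}"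
      proof safe
        fix x
        have "?u \<bullet> (B *v x) = (?a * ?d - ?b * ?c) * x $ 1"
          by (simp add: inner_vec2 matrix_mult_component algebra_simps)
        then show "?u \<bullet> (B *v x) = 0" using det by simp
      next
        fix z assume "?u \<bullet> z = 0"
        then have "crossp ?p z = 0" by (simp add: inner_vec2 crossp_def)
        then obtain t where "z = t *\<^sub>R ?p" using crossp_eq_0_imp_parallel u by metis
        then have "z = B *v vector [0, t]"
          by (simp add: vec_eq_iff forall_2 matrix_mult_component)
        then show "z \<in> range (\<lambda>x. B *v x)" by blast
      qed
      fix z :: vec2
      have "?a * z $ 2 - ?c * z $ 1 = (?d * z $ 1 - ?b * z $ 2) * l"
        unfolding diff_conv_add_uminus mult_minus_left[symmetric] l' by (simp add: algebra_simps)
      then show "adjugate_mult B z = (?u \<bullet> z) *\<^sub>R vector [1, l]"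
        by (simp add: adjugate_mult_def vec_eq_iff forall_2 inner_vec2)
    qed (rule u)
  next
    case True
    let ?u = "vector [- ?c, ?a] :: vec2" and ?p = "vector [?a, ?c] :: vec2"
    have u: "?u \<noteq> 0" "?p \<noteq> 0" using \<open>B \<noteq> 0\<close> True by (auto simp: vec_eq_iff forall_2)
    show ?thesis
    proof (rule that[of ?u "vector [0, 1]"])
      show "(vector [0, 1] :: vec2) \<noteq> 0" by (simp add: vec_eq_iff forall_2)
      show "range (\<lambda>x. B *v x) = {z. ?u \<bullet> z = 0}"
      proof safe
        fix x
        show "?u \<bullet> (B *v x) = 0" using True
          by (simp add: inner_vec2 matrix_mult_component algebra_simps)
      next
        fix z assume "?u \<bullet> z = 0"
        then have "crossp ?p z = 0" by (simp add: inner_vec2 crossp_def algebra_simps)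
        then obtain t where "z = t *\<^sub>R ?p" using crossp_eq_0_imp_parallel u by metis
        then have "z = B *v vector [t, 0]"
          by (simp add: vec_eq_iff forall_2 matrix_mult_component)
        then show "z \<in> range (\<lambda>x. B *v x)" by blast
      qed
      show "adjugate_mult B z = (?u \<bullet> z) *\<^sub>R vector [0, 1]" for z
        using True by (simp add: adjugate_mult_def vec_eq_iff forall_2 inner_vec2)
    qed (rule u)
  qed
qed

lemma orthogonal_comp_line:
  assumes "(u::vec2) \<noteq> 0"
  shows "orthogonal_comp {z. u \<bullet> z = 0} = range (\<lambda>t. t *\<^sub>R u)"
proof safe
  fix y assume "y \<in> orthogonal_comp {z. u \<bullet> z = 0}"
  moreover have "u \<bullet> rot u = 0" by (simp add: inner_vec2)
  ultimately have "rot u \<bullet> y = 0" by (auto simp: orthogonal_comp_def orthogonal_def)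
  then have "crossp u y = 0" by (simp add: inner_vec2 crossp_def)
  then show "y \<in> range (\<lambda>t. t *\<^sub>R u)" using crossp_eq_0_imp_parallel assms by blast
next
  fix t show "t *\<^sub>R u \<in> orthogonal_comp {z. u \<bullet> z = 0}"
    by (auto simp: orthogonal_comp_def orthogonal_def inner_commute)
qed

lemma orth_proj_line:
  assumes "(u::vec2) \<noteq> 0"
  shows "orth_proj (orthogonal_comp {z. u \<bullet> z = 0}) x = ((u \<bullet> x) / (u \<bullet> u)) *\<^sub>R u"
proof -
  let ?L = "orthogonal_comp {z. u \<bullet> z = 0}"
  have perp: "z \<in> orthogonal_comp ?L \<longleftrightarrow> u \<bullet> z = 0" for z
  proof
    assume "z \<in> orthogonal_comp ?L"
    moreover have "1 *\<^sub>R u \<in> ?L" unfolding orthogonal_comp_line[OF assms] by blast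
    ultimately show "u \<bullet> z = 0" unfolding orthogonal_comp_def[of ?L] orthogonal_def by auto
  next
    assume "u \<bullet> z = 0"
    then show "z \<in> orthogonal_comp ?L"
      unfolding orthogonal_comp_line[OF assms] unfolding orthogonal_comp_def orthogonal_def by auto
  qed
  show ?thesis unfolding orth_proj_def
  proof (rule the_equality)
    show "((u \<bullet> x) / (u \<bullet> u)) *\<^sub>R u \<in> ?L \<and> x - ((u \<bullet> x) / (u \<bullet> u)) *\<^sub>R u \<in> orthogonal_comp ?L"
    proof
      show "((u \<bullet> x) / (u \<bullet> u)) *\<^sub>R u \<in> ?L" unfolding orthogonal_comp_line[OF assms] by blast
      show "x - ((u \<bullet> x) / (u \<bullet> u)) *\<^sub>R u \<in> orthogonal_comp ?L"
        unfolding perp using assms by (simp add: inner_diff_right)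
    qed
    fix p assume p: "p \<in> ?L \<and> x - p \<in> orthogonal_comp ?L"
    then obtain t where t: "p = t *\<^sub>R u" unfolding orthogonal_comp_line[OF assms] by blast
    then have "u \<bullet> x = t * (u \<bullet> u)" using p unfolding perp by (simp add: inner_diff_right)
    then show "p = ((u \<bullet> x) / (u \<bullet> u)) *\<^sub>R u" using t assms by simp
  qed
qed

lemma norm_orth_proj_diff:
  assumes "(u::vec2) \<noteq> 0"
  shows "norm (orth_proj (orthogonal_comp {z. u \<bullet> z = 0}) x - orth_proj (orthogonal_comp {z. u \<bullet> z = 0}) y)
    = \<bar>u \<bullet> (x - y)\<bar> / norm u"
proof -
  have "norm (((u \<bullet> x) / (u \<bullet> u)) *\<^sub>R u - ((u \<bullet> y) / (u \<bullet> u)) *\<^sub>R u) = \<bar>(u \<bullet> (x - y)) / (u \<bullet> u)\<bar> * norm u"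
    by (metis diff_divide_distrib inner_diff_right norm_scaleR scaleR_left_diff_distrib)
  also have "\<dots> = \<bar>u \<bullet> (x - y)\<bar> / norm u"
    using assms by (simp add: dot_square_norm power2_eq_square)
  finally show ?thesis by (simp add: orth_proj_line[OF assms])
qed

context contracting_matrices
begin

lemma invertible_letter:
  assumes "i < N"
  shows "invertible (A i)"
proof -
  have "surj ((*v) (A i))" using letter_surj[OF assms] by (metis surjI)
  then show ?thesis using matrix_right_invertible_surjective invertible_right_inverse by blast
qed

lemma word_inv_mat_mult: "w \<in> W \<Longrightarrow> word_inv_mat A w ** M (rev w) = mat 1"
proof (induction w)
  case (Cons i w)
  have "matrix_inv (A i) ** A i = mat 1"
    using invertible_letter[of i] Cons.prems unfolding matrix_inv_def invertible_def
    by (auto intro: someI2_ex)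
  moreover have "word_inv_mat A (i # w) ** M (rev (i # w))
      = matrix_inv (A i) ** (word_inv_mat A w ** M (rev w)) ** A i"
    by (simp add: word_inv_mat_def word_mat_append matrix_mul_assoc)
  ultimately show ?case using Cons by simp
qed (simp add: word_inv_mat_def)

text \<open>The adjugate of a product of inverses is a multiple of the product along the reversed
  word. Convergence of inverse products to \<open>B\<close> thus becomes convergence of forward
  products to the adjugate of \<open>B\<close>, whose kernel is the range of
  \<open>B\<close>.\<close>

lemma furstenberg_limit_row:
  assumes "V \<in> furstenberg_dirs N A"
  obtains u where "limit_row N A u" "V = {z. u \<bullet> z = 0}"
proof -
  obtain B where V: "V = range (\<lambda>x. B *v x)" and rank: "rank B = 1"
    and cl: "B \<in> closure {c *\<^sub>R word_inv_mat A w | c w. w \<in> W}"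
    using assms unfolding furstenberg_dirs_def by blast
  obtain u e where u: "u \<noteq> 0" and e: "e \<noteq> 0" and range: "range (\<lambda>x. B *v x) = {z. u \<bullet> z = 0}"
    and adj: "\<And>z. adjugate_mult B z = (u \<bullet> z) *\<^sub>R e"
    by (rule rank_one_adjugate[OF rank]) blast
  have "\<exists>w\<in>W. \<exists>c. \<forall>z. norm (c *\<^sub>R (M w *v z) - (u \<bullet> z) *\<^sub>R e) \<le> \<epsilon> * norm z" if eps: "\<epsilon> > 0" for \<epsilon>
  proof -
    obtain c w where w: "w \<in> W" and d: "dist (c *\<^sub>R word_inv_mat A w) B \<le> \<epsilon> / 4"
    proof -
      have "\<epsilon> / 4 > 0" using eps by simp
      then show ?thesis using cl that unfolding closure_approachable_le by blast
    qed
    let ?I = "word_inv_mat A w"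
    have "norm ((c * det ?I) *\<^sub>R (M (rev w) *v z) - (u \<bullet> z) *\<^sub>R e) \<le> \<epsilon> * norm z" for z
    proof -
      have "?I *v (M (rev w) *v z) = z"
        by (simp add: matrix_vector_mul_assoc word_inv_mat_mult[OF w])
      then have "adjugate_mult ?I z = det ?I *\<^sub>R (M (rev w) *v z)"
        using adjugate_mult_matrix[of ?I "M (rev w) *v z"] by simp
      then have "(c * det ?I) *\<^sub>R (M (rev w) *v z) - (u \<bullet> z) *\<^sub>R e = adjugate_mult (c *\<^sub>R ?I - B) z"
        by (simp add: adjugate_mult_diff adjugate_mult_scaleR adj)
      also have "norm \<dots> \<le> 4 * (norm (c *\<^sub>R ?I - B) * norm z)" by (rule norm_adjugate_mult_le)
      also have "\<dots> \<le> 4 * (\<epsilon> / 4 * norm z)"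
        using d by (intro mult_left_mono mult_right_mono) (auto simp: dist_norm)
      finally show ?thesis by simp
    qed
    moreover have "rev w \<in> W" using w by auto
    ultimately show ?thesis by blast
  qed
  then have "limit_row N A u" unfolding limit_row_def using u e by blast
  then show ?thesis using that V range by simp
qed

end

section \<open>Coding of the self-affine set by words\<close>

locale self_affine = contracting_matrices +
  fixes v :: "nat \<Rightarrow> vec2" and X :: "vec2 set"
  assumes two_maps: "2 \<le> N" and X_nonempty: "X \<noteq> {}" and X_compact: "compact X"
    and X_eq: "X = (\<Union>i<N. aff A v i ` X)" and separation: "strong_separation N A v X"
begin

abbreviation "f \<equiv> word_map A v"

lemma word_map_in: "w \<in> W \<Longrightarrow> x \<in> X \<Longrightarrow> f w x \<in> X"
proof (induction w)
  case (Cons i w)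
  then have "aff A v i (f w x) \<in> (\<Union>i<N. aff A v i ` X)" by auto
  then show ?case using X_eq by simp
qed simp

lemma address:
  "y \<in> X \<Longrightarrow> \<exists>w\<in>W. length w = n \<and> y \<in> f w ` X"
proof (induction n arbitrary: y)
  case 0
  then show ?case by (intro bexI[of _ "[]"]) auto
next
  case (Suc n)
  obtain i x where i: "i < N" and x: "x \<in> X" and y: "y = aff A v i x"
    using Suc.prems X_eq by blast
  obtain w where "w \<in> W" "length w = n" "x \<in> f w ` X" using Suc.IH[OF x] by blast
  then show ?case using i y by (intro bexI[of _ "i # w"]) auto
qed

lemma word_map_lipschitz: "w \<in> W \<Longrightarrow> norm (f w x - f w y) \<le> \<rho> ^ length w * norm (x - y)"
  by (simp add: word_map_diff norm_word_le)

lemma word_map_inj: "w \<in> W \<Longrightarrow> f w x = f w y \<longleftrightarrow> x = y"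
  using word_map_diff[of A v w x y] word_mat_eq_0_iff[of w "x - y"] by auto

lemma norm_diff_le_diameter: "x \<in> X \<Longrightarrow> y \<in> X \<Longrightarrow> norm (x - y) \<le> diameter X"
  using diameter_bounded_bound[OF compact_imp_bounded[OF X_compact]] by (simp add: dist_norm)

lemma distinct_first_letters: "i < N \<Longrightarrow> j < N \<Longrightarrow> i \<noteq> j \<Longrightarrow> x \<in> X \<Longrightarrow> y \<in> X \<Longrightarrow> aff A v i x \<noteq> aff A v j y"
  using separation unfolding strong_separation_def by blast

lemma X_two_points: "\<exists>x\<in>X. \<exists>y\<in>X. x \<noteq> y"
proof -
  obtain x where x: "x \<in> X" using X_nonempty by blast
  have "f [0] x \<in> X" "f [1] x \<in> X" by (rule word_map_in; use x two_maps in simp)+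
  moreover have "f [0] x \<noteq> f [1] x" using distinct_first_letters[of 0 1 x x] x two_maps by simp
  ultimately show ?thesis by blast
qed

lemma word_map_neq_id:
  assumes "w \<in> W" "w \<noteq> []"
  shows "\<exists>x\<in>X. f w x \<noteq> x"
proof (rule ccontr)
  assume no: "\<not> ?thesis"
  obtain x y where xy: "x \<in> X" "y \<in> X" "x \<noteq> y" using X_two_points by blast
  then have "norm (x - y) \<le> \<rho> ^ length w * norm (x - y)"
    using no word_map_lipschitz[OF assms(1), of x y] by simp
  moreover have "\<rho> ^ length w < 1" using assms(2) rho by (simp add: power_less_one_iff)
  ultimately show False using xy by (simp add: mult_le_cancel_right1)
qed

text \<open>Common first letters cancel by injectivity, and different first letters are told apart
  by strong separation. If one word is a proper prefix of the other, the rest is a strict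
  contraction, which cannot fix two points of \<open>X\<close>.\<close>

lemma word_maps_differ:
  "w \<in> W \<Longrightarrow> u \<in> W \<Longrightarrow> w \<noteq> u \<Longrightarrow> \<exists>x\<in>X. f w x \<noteq> f u x"
proof (induction w arbitrary: u)
  case Nil
  then show ?case using word_map_neq_id[of u] by force
next
  case (Cons i w)
  show ?case
  proof (cases u)
    case Nil
    then show ?thesis using word_map_neq_id[of "i # w"] Cons.prems by force
  next
    case (Cons j u')
    have ij: "i < N" "j < N" "w \<in> W" "u' \<in> W" using Cons.prems Cons by auto
    show ?thesis
    proof (cases "i = j")
      case True
      then obtain x where x: "x \<in> X" "f w x \<noteq> f u' x" using Cons.IH[of u'] Cons.prems Cons by auto
      then have "aff A v i (f w x) \<noteq> aff A v i (f u' x)"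
        using word_map_inj[of "[i]"] ij by simp
      then show ?thesis using x Cons True by auto
    next
      case False
      obtain x where x: "x \<in> X" using X_nonempty by blast
      then show ?thesis
        using distinct_first_letters[of i j "f w x" "f u' x"] ij False Cons word_map_in by auto
    qed
  qed
qed

text \<open>A failure of the projective open set condition along \<^term>\<open>V\<close> only controls the displacement
  transversally to \<^term>\<open>V\<close>. Prepending a word whose matrix is close to a rank one matrix with
  kernel \<^term>\<open>V\<close> turns this into control of the full displacement.\<close>
lemma small_displacement:
  assumes posc: "\<not> proj_open_set_condition N A v X" and eta: "\<eta> > 0"
  obtains I J where "I \<in> W" "J \<in> W" "\<And>x. x \<in> X \<Longrightarrow> norm (f I x - f J x) \<le> \<eta> * sv1 (M I)"
    "\<exists>x\<in>X. f I x \<noteq> f J x"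
proof -
  let ?D = "diameter X"
  have D: "0 \<le> ?D" by (rule diameter_ge_0[OF compact_imp_bounded[OF X_compact]])
  \<comment> \<open>The 2 compensates the half in \<open>?T / 2\<close> below. The summand 1 pays
    for the error of the rank one approximation and keeps the denominator positive.\<close>
  define \<eta>' where "\<eta>' = \<eta> / (2 * (?D + 1))"
  have e': "\<eta>' > 0" using eta D by (simp add: \<eta>'_def)
  obtain V w u where V: "V \<in> furstenberg_dirs N A" and w: "w \<in> W" and u: "u \<in> W" and wu: "w \<noteq> u"
    and small: "\<And>x. x \<in> X \<Longrightarrow> norm (orth_proj (orthogonal_comp V) (f w x) - orth_proj (orthogonal_comp V) (f u x))
        < \<eta>' * diameter (orth_proj (orthogonal_comp V) ` f w ` X)"
    using posc e' unfolding proj_open_set_condition_def by (meson not_le)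
  obtain a where a: "limit_row N A a" and Va: "V = {z. a \<bullet> z = 0}"
    using furstenberg_limit_row[OF V] .
  obtain e where anz: "a \<noteq> 0" and enz: "e \<noteq> 0" and
    lim: "\<And>\<epsilon>. \<epsilon> > 0 \<Longrightarrow> \<exists>w\<in>W. \<exists>c. \<forall>z. norm (c *\<^sub>R (M w *v z) - (a \<bullet> z) *\<^sub>R e) \<le> \<epsilon> * norm z"
    using a unfolding limit_row_def by blast
  define h where "h = a v* M w"
  have h: "a \<bullet> (M w *v z) = h \<bullet> z" for z by (simp add: h_def dot_lmul_matrix)
  have diam: "diameter (orth_proj (orthogonal_comp V) ` f w ` X) \<le> norm h * ?D / norm a"
  proof (rule diameter_le)
    show "orth_proj (orthogonal_comp V) ` f w ` X \<noteq> {} \<or> 0 \<le> norm h * ?D / norm a"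
      using X_nonempty by simp
    fix p q assume "p \<in> orth_proj (orthogonal_comp V) ` f w ` X" "q \<in> orth_proj (orthogonal_comp V) ` f w ` X"
    then obtain x y where xy: "x \<in> X" "y \<in> X"
      and pq: "p = orth_proj (orthogonal_comp V) (f w x)" "q = orth_proj (orthogonal_comp V) (f w y)" by auto
    have "norm (p - q) = \<bar>h \<bullet> (x - y)\<bar> / norm a"
      unfolding pq Va norm_orth_proj_diff[OF anz] word_map_diff h ..
    also have "\<bar>h \<bullet> (x - y)\<bar> \<le> norm h * ?D"
      using Cauchy_Schwarz_ineq2[of h "x - y"] mult_left_mono[OF norm_diff_le_diameter[OF xy], of "norm h"] by simp
    finally show "norm (p - q) \<le> norm h * ?D / norm a" by (simp add: divide_right_mono)
  qed
  have trans: "\<bar>a \<bullet> (f w x - f u x)\<bar> \<le> \<eta>' * norm h * ?D" if "x \<in> X" for x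
  proof -
    have "\<bar>a \<bullet> (f w x - f u x)\<bar> / norm a \<le> \<eta>' * (norm h * ?D / norm a)"
      using small[OF that] mult_left_mono[OF diam, of \<eta>'] e'
      unfolding Va norm_orth_proj_diff[OF anz] by linarith
    then show ?thesis using anz by (simp add: field_simps)
  qed
  have hnz: "h \<noteq> 0"
  proof
    assume "h = 0"
    obtain x where x: "x \<in> X" using X_nonempty by blast
    have "diameter (orth_proj (orthogonal_comp V) ` f w ` X) \<le> 0" using diam \<open>h = 0\<close> by simp
    then have "\<eta>' * diameter (orth_proj (orthogonal_comp V) ` f w ` X) \<le> 0"
      using e' by (simp add: mult_le_0_iff)
    then have "norm (orth_proj (orthogonal_comp V) (f w x) - orth_proj (orthogonal_comp V) (f u x)) < 0"
      using small[OF x] by linarith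
    then show False by simp
  qed
  let ?T = "norm h * norm e"
  have T: "?T > 0" using hnz enz by simp
  \<comment> \<open>This tolerance depends on \<open>h\<close> and so on \<open>w\<close>, which is
    harmless because the prefix \<open>k\<close> is chosen after \<open>w\<close> and
    \<open>u\<close>.\<close>
  define \<epsilon> where "\<epsilon> = min (?T / 2) (\<eta>' * ?T / (?D + 1))"
  have eps: "\<epsilon> > 0" "\<epsilon> \<le> ?T / 2" "\<epsilon> * ?D \<le> \<eta>' * ?T"
  proof -
    show "\<epsilon> > 0" using T e' D by (simp add: \<epsilon>_def)
    show "\<epsilon> \<le> ?T / 2" unfolding \<epsilon>_def by (rule min.cobounded1)
    have "\<epsilon> * ?D \<le> \<eta>' * ?T / (?D + 1) * (?D + 1)"
      using D T e' by (intro mult_mono) (auto simp: \<epsilon>_def)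
    then show "\<epsilon> * ?D \<le> \<eta>' * ?T" using D by simp
  qed
  obtain k c where k: "k \<in> W" and ap: "\<And>z. norm (c *\<^sub>R (M k *v z) - (a \<bullet> z) *\<^sub>R e) \<le> \<epsilon> * norm z"
    using lim[OF eps(1)] by blast
  have ap': "\<bar>\<bar>c\<bar> * norm (M k *v z) - \<bar>a \<bullet> z\<bar> * norm e\<bar> \<le> \<epsilon> * norm z" for z
    using ap[of z] norm_triangle_ineq3[of "c *\<^sub>R (M k *v z)" "(a \<bullet> z) *\<^sub>R e"] by simp
  have big: "?T / 2 \<le> \<bar>c\<bar> * sv1 (M (k @ w))"
  proof -
    have "\<bar>h \<bullet> h\<bar> * norm e - \<epsilon> * norm h \<le> \<bar>c\<bar> * norm (M k *v (M w *v h))"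
      using ap'[of "M w *v h"] mult_left_mono[OF norm_word_le_norm[OF w, of h], of \<epsilon>] eps(1)
      unfolding h by linarith
    also have "\<dots> \<le> \<bar>c\<bar> * (sv1 (M (k @ w)) * norm h)"
      using norm_mult_le_sv1[of "M (k @ w)" h]
      by (intro mult_left_mono) (simp_all add: word_mat_append matrix_vector_mul_assoc)
    finally have "(?T - \<epsilon>) * norm h \<le> (\<bar>c\<bar> * sv1 (M (k @ w))) * norm h"
      by (simp add: dot_square_norm power2_eq_square algebra_simps)
    then have "?T - \<epsilon> \<le> \<bar>c\<bar> * sv1 (M (k @ w))"
      using hnz by (simp only: mult_le_cancel_right zero_less_norm_iff) simp
    then show ?thesis using eps by linarith
  qed
  then have c: "c \<noteq> 0" using T by auto
  show ?thesis
  proof (rule that[of "k @ w" "k @ u"])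
    show "k @ w \<in> W" "k @ u \<in> W" using k w u by auto
    obtain x where "x \<in> X" "f w x \<noteq> f u x" using word_maps_differ[OF w u wu] by blast
    then show "\<exists>x\<in>X. f (k @ w) x \<noteq> f (k @ u) x"
      using word_map_inj[OF k] by (intro bexI[of _ x]) (auto simp: word_map_append)
    fix x assume x: "x \<in> X"
    let ?d = "f w x - f u x"
    have dD: "norm ?d \<le> ?D" using norm_diff_le_diameter word_map_in w u x by simp
    have "\<bar>c\<bar> * norm (M k *v ?d) \<le> \<bar>a \<bullet> ?d\<bar> * norm e + \<epsilon> * norm ?d"
      using ap'[of ?d] by linarith
    also have "\<dots> \<le> \<eta>' * norm h * ?D * norm e + \<epsilon> * ?D"
      using trans[OF x] dD eps(1) by (intro add_mono mult_right_mono mult_left_mono) auto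
    also have "\<dots> \<le> \<eta>' * (?D + 1) * ?T" using eps(3) by (simp add: algebra_simps)
    also have "\<dots> = \<eta> * (?T / 2)"
    proof -
      have "\<eta> / (2 * b) * b = \<eta> / 2" if "b > 0" for b using that by simp
      from this[of "?D + 1"] have "\<eta>' * (?D + 1) = \<eta> / 2" using D unfolding \<eta>'_def by linarith
      then show ?thesis by (simp only:)
    qed
    also have "\<dots> \<le> \<eta> * (\<bar>c\<bar> * sv1 (M (k @ w)))" using big eta by (intro mult_left_mono) auto
    finally have "\<bar>c\<bar> * norm (M k *v ?d) \<le> \<bar>c\<bar> * (\<eta> * sv1 (M (k @ w)))" by (simp add: mult_ac)
    then have "norm (M k *v ?d) \<le> \<eta> * sv1 (M (k @ w))" using c by simp
    then show "norm (f (k @ w) x - f (k @ u) x) \<le> \<eta> * sv1 (M (k @ w))"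
      by (simp add: word_map_append word_map_diff)
  qed
qed

end

section \<open>Walks\<close>

text \<open>A bound for an affine map on \<open>X\<close> controls its linear part on differences of
  points of \<open>X\<close>, and a basis of their span consists of such differences. The constant
  depends only on \<open>X\<close>, which allows it to be fixed before the words \<open>I\<close>
  and \<open>J\<close>. Directions outside that span stay uncontrolled, hence the restriction to
  points of \<open>X\<close>.\<close>

lemma affine_lipschitz_on:
  fixes X :: "vec2 set"
  obtains K where "K \<ge> 0"
    "\<And>d L S x y. \<lbrakk>\<And>x y. d x - d y = L *v (x - y); \<And>x. x \<in> X \<Longrightarrow> norm (d x :: vec2) \<le> S; x \<in> X; y \<in> X\<rbrakk>
      \<Longrightarrow> norm (d x - d y) \<le> K * S * norm (x - y)"
proof -
  let ?D = "{x - y | x y. x \<in> X \<and> y \<in> X}"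
  obtain B where B: "B \<subseteq> ?D" "independent B" "?D \<subseteq> span B"
    using maximal_independent_subset by blast
  have fin: "finite B" using B(2) by (rule independent_imp_finite)
  have "\<exists>g. linear g \<and> (\<forall>x\<in>B. g x = (if x = b then 1 else 0 :: real))" for b
    using linear_independent_extend[OF B(2), of "\<lambda>x. if x = b then 1 else 0"] by simp
  then obtain g where lin: "\<And>b. linear (g b)" and g: "\<And>b x. x \<in> B \<Longrightarrow> g b x = (if x = b then 1 else 0 :: real)"
    by metis
  have "\<exists>k\<ge>0. \<forall>z. \<bar>g b z\<bar> \<le> norm z * k" for b
  proof -
    have "bounded_linear (g b)" using lin linear_conv_bounded_linear by blast
    from bounded_linear.nonneg_bounded[OF this] show ?thesis by simp
  qed
  then obtain k where k: "\<And>b. 0 \<le> k b" "\<And>b z. \<bar>g b z\<bar> \<le> norm z * k b" by metis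
  have expand: "z = (\<Sum>b\<in>B. g b z *\<^sub>R b)" if "z \<in> span B" for z
  proof (rule linear_eq_on_span[OF _ _ _ that])
    show "linear (\<lambda>z. z :: vec2)" by (simp add: linear_iff)
    show "linear (\<lambda>z. \<Sum>b\<in>B. g b z *\<^sub>R b)"
      using lin by (intro linear_compose_sum) (auto simp: linear_iff scaleR_left_distrib)
    fix z assume z: "z \<in> B"
    have "(\<Sum>b\<in>B. g b z *\<^sub>R b) = (\<Sum>b\<in>B. if z = b then b else 0)"
      by (intro sum.cong) (auto simp: g[OF z])
    then show "z = (\<Sum>b\<in>B. g b z *\<^sub>R b)" using fin z by simp
  qed
  show ?thesis
  proof (rule that[of "\<Sum>b\<in>B. 2 * k b"])
    show "0 \<le> (\<Sum>b\<in>B. 2 * k b)" using k by (simp add: sum_nonneg)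
    fix d L S x y assume d: "\<And>x y. d x - d y = L *v (x - y)" and S: "\<And>x. x \<in> X \<Longrightarrow> norm (d x :: vec2) \<le> S"
      and xy: "x \<in> X" "y \<in> X"
    have Lb: "norm (L *v b) \<le> 2 * S" if b: "b \<in> B" for b
    proof -
      obtain p q where "p \<in> X" "q \<in> X" "b = p - q" using b B(1) by blast
      then show ?thesis using d[of p q] S[of p] S[of q] norm_triangle_ineq4[of "d p" "d q"] by simp
    qed
    have "x - y \<in> span B" using B(3) xy by blast
    then have "L *v (x - y) = (\<Sum>b\<in>B. g b (x - y) *\<^sub>R (L *v b))"
      using arg_cong[OF expand, of "x - y" "(*v) L"]
      by (simp only: linear_sum[OF matrix_vector_mul_linear] matrix_vector_mult_scaleR)
    then have "norm (d x - d y) \<le> (\<Sum>b\<in>B. norm (g b (x - y) *\<^sub>R (L *v b)))"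
      using d norm_sum by metis
    also have "\<dots> \<le> (\<Sum>b\<in>B. 2 * k b * S * norm (x - y))"
    proof (rule sum_mono)
      fix b assume b: "b \<in> B"
      have "norm (g b (x - y) *\<^sub>R (L *v b)) \<le> (norm (x - y) * k b) * (2 * S)"
        using k Lb[OF b] by (simp add: mult_mono)
      then show "norm (g b (x - y) *\<^sub>R (L *v b)) \<le> 2 * k b * S * norm (x - y)"
        by (simp add: mult_ac)
    qed
    finally show "norm (d x - d y) \<le> (\<Sum>b\<in>B. 2 * k b) * S * norm (x - y)"
      by (simp add: sum_distrib_right)
  qed
qed

text \<open>The factor \<open>r\<close> cancels the component along \<open>rot s\<close>, leaving a
  multiple of \<open>M *v s\<close>, which has norm \<open>sv2 M\<close>. Since \<open>z\<close> is
  not contracted much, its component along \<open>rot s\<close> is at least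
  \<open>c / 2 * norm z\<close>, and this keeps \<open>r\<close> bounded.\<close>

lemma nearly_parallel_images:
  assumes c: "0 < c" and M: "sv1 M > 0" "sv2 M \<le> c / 2 * sv1 M"
    and z: "z \<noteq> 0" "c * sv1 M * norm z \<le> norm (M *v z)"
  obtains r where "norm (M *v y - r *\<^sub>R (M *v z)) \<le> sv2 M * (1 + 2 / c) * norm y"
proof -
  obtain s where s: "norm s = 1" "norm (M *v s) = sv2 M" by (rule sv2_attained)
  let ?p = "rot s"
  have p1: "norm ?p = 1" using s by simp
  have dec: "M *v x = (s \<bullet> x) *\<^sub>R (M *v s) + (?p \<bullet> x) *\<^sub>R (M *v ?p)" for x
    by (subst rot_frame[OF s(1), of x]) (simp add: matrix_vector_right_distrib matrix_vector_mult_scaleR)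
  have "norm (M *v z) \<le> \<bar>s \<bullet> z\<bar> * sv2 M + \<bar>?p \<bullet> z\<bar> * norm (M *v ?p)"
    using norm_triangle_ineq[of "(s \<bullet> z) *\<^sub>R (M *v s)" "(?p \<bullet> z) *\<^sub>R (M *v ?p)"] dec[of z] s by simp
  also have "\<dots> \<le> norm z * (c / 2 * sv1 M) + \<bar>?p \<bullet> z\<bar> * sv1 M"
    using M s abs_inner_le_1[OF s(1), of z] norm_mult_le_sv1[of M ?p]
    by (intro add_mono mult_mono) auto
  finally have "c / 2 * norm z * sv1 M \<le> \<bar>?p \<bullet> z\<bar> * sv1 M" using z(2) by (simp add: algebra_simps)
  then have pz: "c / 2 * norm z \<le> \<bar>?p \<bullet> z\<bar>" using M(1) by (simp only: mult_le_cancel_right_pos)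
  then have pz0: "?p \<bullet> z \<noteq> 0" using z c by (auto simp: mult_le_0_iff)
  let ?r = "(?p \<bullet> y) / (?p \<bullet> z)"
  have ry: "\<bar>?r\<bar> * norm z \<le> 2 / c * norm y"
  proof -
    have "\<bar>?r\<bar> * (c / 2 * norm z) \<le> \<bar>?r\<bar> * \<bar>?p \<bullet> z\<bar>" using pz by (intro mult_left_mono) auto
    also have "\<dots> = \<bar>?p \<bullet> y\<bar>" using pz0 by (simp add: abs_divide)
    also have "\<dots> \<le> norm y" by (rule abs_inner_le_1[OF p1])
    finally have "\<bar>?r\<bar> * (c / 2 * norm z) \<le> norm y" .
    moreover have "g * b \<le> 2 / c * h" if "g * (c / 2 * b) \<le> h" for g b h
      using that c by (simp add: field_simps)
    ultimately show ?thesis by blast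
  qed
  have "M *v y - ?r *\<^sub>R (M *v z) = (s \<bullet> y - ?r * (s \<bullet> z)) *\<^sub>R (M *v s)"
    unfolding dec[of y] dec[of z] using pz0 by (simp add: algebra_simps)
  then have "norm (M *v y - ?r *\<^sub>R (M *v z)) = \<bar>s \<bullet> y - ?r * (s \<bullet> z)\<bar> * sv2 M" using s by simp
  also have "\<dots> \<le> (norm y + 2 / c * norm y) * sv2 M"
  proof (rule mult_right_mono)
    have "\<bar>?r * (s \<bullet> z)\<bar> \<le> \<bar>?r\<bar> * norm z"
      unfolding abs_mult by (intro mult_left_mono abs_inner_le_1 s) simp
    then show "\<bar>s \<bullet> y - ?r * (s \<bullet> z)\<bar> \<le> norm y + 2 / c * norm y"
      using ry abs_inner_le_1[OF s(1), of y] by linarith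
  qed simp
  also have "\<dots> = sv2 M * (1 + 2 / c) * norm y" by (simp add: algebra_simps)
  finally show ?thesis by (rule that)
qed

context self_affine
begin

text \<open>Along an address of \<open>y\<close> the norm eventually drops below \<open>T\<close>;
  the prefix just before the drop overshoots by at most the factor \<open>1 / \<kappa>\<close> of
  one letter. The upper bound on \<open>T\<close> keeps the drop from occurring within the first
  \<open>n0\<close> letters.\<close>

lemma prefix_match:
  assumes y: "y \<in> X" and I: "I \<in> W" and T: "0 < T" "T \<le> \<kappa> ^ n0 * sv1 (M I)"
  obtains w where "w \<in> W" "n0 \<le> length w" "y \<in> f w ` X"
    "T \<le> sv1 (M (I @ w))" "\<kappa> * sv1 (M (I @ w)) \<le> T"
proof -
  have grow: "\<kappa> ^ length u * sv1 (M w) \<le> sv1 (M (w @ u))" if "u \<in> W" for w u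
    using sv1_mult_sv2_le[of "M w" "M u"] mult_right_mono[OF sv2_word_ge[OF that] sv1_nonneg[of "M w"]]
    by (simp add: word_mat_append mult.commute)
  obtain n where n: "\<rho> ^ n < T" using real_arch_pow_inv[OF T(1) rho(2)] by blast
  obtain u where u: "u \<in> W" "length u = n" "y \<in> f u ` X" using address[OF y] by blast
  have tk: "take j u \<in> W" for j using u(1) by (auto dest: in_set_takeD)
  define P where "P j \<longleftrightarrow> sv1 (M (I @ take j u)) < T" for j
  have Pn: "P n"
  proof -
    have "I @ u \<in> W" using I u by simp
    then have "sv1 (M (I @ u)) \<le> \<rho> ^ (length I + n)" using sv1_word_le[of "I @ u"] u by simp
    also have "\<dots> \<le> \<rho> ^ n" using rho by (intro power_decreasing) auto
    finally show ?thesis using n u by (simp add: P_def)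
  qed
  define j where "j = (LEAST j. P j)"
  have Pj: "P j" unfolding j_def using Pn by (rule LeastI)
  have jn: "j \<le> n" unfolding j_def using Pn by (rule Least_le)
  \<comment> \<open>Strictness is needed because the prefix returned has length
    \<open>j - 1\<close>.\<close>
  have "n0 < j"
  proof (rule ccontr)
    assume "\<not> n0 < j"
    then have "\<kappa> ^ n0 \<le> \<kappa> ^ length (take j u)" using kappa by (intro power_decreasing) auto
    then have "\<kappa> ^ n0 * sv1 (M I) \<le> sv1 (M (I @ take j u))"
      using grow[OF tk, of j I] mult_right_mono[OF _ sv1_nonneg] by (meson order_trans)
    then show False using Pj T by (simp add: P_def)
  qed
  then obtain i where i: "j = Suc i" by (cases j) auto
  let ?w = "take i u"
  have lt: "i < length u" using jn i u by simp
  have notP: "\<not> P i" using not_less_Least[of i P] i j_def by simp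
  show ?thesis
  proof (rule that[of ?w])
    show "?w \<in> W" by (rule tk)
    show "n0 \<le> length ?w" using \<open>n0 < j\<close> i lt by simp
    obtain x where x: "x \<in> X" "y = f u x" using u by blast
    have "y = f ?w (f (drop i u) x)" using x by (simp add: word_map_append[unfolded o_def fun_eq_iff, rule_format, symmetric])
    moreover have "drop i u \<in> W" using u(1) by (auto dest: in_set_dropD)
    ultimately show "y \<in> f ?w ` X" using word_map_in x by blast
    show "T \<le> sv1 (M (I @ ?w))" using notP by (simp add: P_def)
    have "[u ! i] \<in> W" using u(1) lt by (auto simp: in_lists_conv_set)
    from grow[OF this, of "I @ ?w"] have "\<kappa> * sv1 (M (I @ ?w)) \<le> sv1 (M (I @ take j u))"
      using lt by (simp add: i take_Suc_conv_app_nth)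
    then show "\<kappa> * sv1 (M (I @ ?w)) \<le> T" using Pj by (simp add: P_def)
  qed
qed

end

text \<open>The scale is carried by \<open>a\<close> alone: an affine map replaces \<open>a\<close>
  by its image under the linear part and leaves the relative lengths \<open>t\<close> unchanged. So
  \<open>r\<close> and \<open>R\<close> need not depend on \<open>m\<close>, although the walks
  shrink.\<close>

definition walk :: "vec2 set \<Rightarrow> real \<Rightarrow> real \<Rightarrow> nat \<Rightarrow> real \<Rightarrow> (nat \<Rightarrow> vec2) \<Rightarrow> vec2 \<Rightarrow> (nat \<Rightarrow> real) \<Rightarrow> bool" where
  "walk X r R m \<epsilon> x a t \<longleftrightarrow> a \<noteq> 0 \<and> (\<forall>l\<le>m. x l \<in> X) \<and>
     (\<forall>l<m. r \<le> t l \<and> t l \<le> R \<and> norm (x (Suc l) - x l - t l *\<^sub>R a) \<le> \<epsilon> * norm a)"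

lemma walk_append:
  assumes "walk X r R m \<epsilon> x a t" "z \<in> X" "r \<le> s" "s \<le> R" "norm (z - x m - s *\<^sub>R a) \<le> \<epsilon> * norm a"
  shows "walk X r R (Suc m) \<epsilon> (\<lambda>l. if l \<le> m then x l else z) a (\<lambda>l. if l < m then t l else s)"
proof -
  show ?thesis using assms unfolding walk_def by (auto simp: less_Suc_eq)
qed

lemma walk_prepend:
  assumes "walk X r R m \<epsilon> x a t" "z \<in> X" "r \<le> s" "s \<le> R" "norm (x 0 - z - s *\<^sub>R a) \<le> \<epsilon> * norm a"
  shows "walk X r R (Suc m) \<epsilon> (case_nat z x) a (case_nat s t)"
  using assms unfolding walk_def by (auto split: nat.splits simp: le_Suc_eq less_Suc_eq_le)

context dominated_matrices
begin

lemma thin_word: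
  assumes "\<delta> > 0" "0 < N"
  obtains q where "q \<in> W" "sv2 (M q) \<le> \<delta> * sv1 (M q)"
proof -
  obtain n where n: "\<tau> ^ n < \<delta> / C"
    using real_arch_pow_inv[of "\<delta> / C" \<tau>] tau C assms(1) by (meson divide_pos_pos)
  show ?thesis
  proof (rule that[of "replicate n 0"])
    show w: "replicate n 0 \<in> W" using assms(2) by auto
    have "C * \<tau> ^ n \<le> \<delta>" using n C by (simp add: pos_less_divide_eq mult.commute)
    then show "sv2 (M (replicate n 0)) \<le> \<delta> * sv1 (M (replicate n 0))"
      using domination[OF w] mult_right_mono[OF _ sv1_nonneg[of "M (replicate n 0)"]] by fastforce
  qed
qed

end

locale dominated_self_affine =
  dominated_matrices N A \<kappa> \<rho> C \<tau> + self_affine N A \<kappa> \<rho> v X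
  for N A \<kappa> \<rho> C \<tau> v X
begin

text \<open>The walk is moved by \<^term>\<open>f (q @ k @ I @ w @ k1)\<close>, where \<^term>\<open>f I\<close> and \<^term>\<open>f J\<close> almost agree
  on \<^term>\<open>X\<close>, and the image of one of its end points under \<^term>\<open>f (q @ k @ J @ w @ k1)\<close> becomes a
  new end point. The word \<^term>\<open>w\<close> adjusts the size of the old steps to the size of the new one,
  \<^term>\<open>k\<close> and \<^term>\<open>k1\<close> avoid the contracted directions, and \<^term>\<open>q\<close> aligns the steps.\<close>
lemma walk_extend:
  assumes c: "0 < c" "c \<le> 1"
    and suffix: "\<And>E F. \<exists>k\<in>W. \<forall>i\<in>W. c * sv1 (M i) * norm E \<le> norm (M (i @ k) *v E) \<and>
       c * sv1 (M i) * norm F \<le> norm (M (i @ k) *v F)"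
    and posc: "\<not> proj_open_set_condition N A v X"
    and eps: "\<epsilon> > 0"
    and walk: "walk X (c * \<kappa> / 2) (2 / c\<^sup>2) m (c\<^sup>2 * \<epsilon>) x a t"
  shows "\<exists>x' a' t'. walk X (c * \<kappa> / 2) (2 / c\<^sup>2) (Suc m) \<epsilon> x' a' t'"
proof -
  have a0: "a \<noteq> 0" and xX: "\<And>l. l \<le> m \<Longrightarrow> x l \<in> X"
    and gap: "\<And>l. l < m \<Longrightarrow> norm (x (Suc l) - x l - t l *\<^sub>R a) \<le> c\<^sup>2 * \<epsilon> * norm a"
    and tl: "\<And>l. l < m \<Longrightarrow> c * \<kappa> / 2 \<le> t l \<and> t l \<le> 2 / c\<^sup>2"
    using walk unfolding walk_def by auto
  let ?D = "norm a" and ?\<Delta> = "diameter X"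
  have D: "?D > 0" using a0 by simp
  have diam: "0 \<le> ?\<Delta>" by (rule diameter_ge_0[OF compact_imp_bounded[OF X_compact]])
  obtain k1 where k1: "k1 \<in> W" "\<And>i. i \<in> W \<Longrightarrow> c * sv1 (M i) * ?D \<le> norm (M (i @ k1) *v a)"
    using suffix[of a a] by blast
  obtain K where K: "K \<ge> 0"
    "\<And>d L S x y. \<lbrakk>\<And>x y. d x - d y = L *v (x - y); \<And>x. x \<in> X \<Longrightarrow> norm (d x :: vec2) \<le> S; x \<in> X; y \<in> X\<rbrakk>
      \<Longrightarrow> norm (d x - d y) \<le> K * S * norm (x - y)"
    using affine_lipschitz_on[of X] by metis
  \<comment> \<open>Two errors proportional to \<open>\<delta>\<close>, one from the variation of
    \<open>d\<close> and one from the alignment, must add up to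
    \<open>\<epsilon> * c\<^sup>2\<close> times the same size.\<close>
  define \<delta> where "\<delta> = \<epsilon> * c\<^sup>2 / 2"
  have delta: "\<delta> > 0" using eps c by (simp add: \<delta>_def)
  obtain n0 where n0: "K * (\<rho> ^ n0 * ?\<Delta>) \<le> \<delta>"
  proof -
    obtain n where n: "\<rho> ^ n < \<delta> / (K * ?\<Delta> + 1)"
      using real_arch_pow_inv[of "\<delta> / (K * ?\<Delta> + 1)" \<rho>] rho delta K(1) diam
      by (meson add_nonneg_pos divide_pos_pos mult_nonneg_nonneg zero_less_one)
    have pos: "K * ?\<Delta> + 1 > 0" using K(1) diam by (simp add: add_nonneg_pos)
    have "\<rho> ^ n * (K * ?\<Delta>) \<le> \<rho> ^ n * (K * ?\<Delta> + 1)" using rho by (intro mult_left_mono) auto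
    also have "\<dots> \<le> \<delta>" using n pos by (simp add: pos_less_divide_eq)
    finally show ?thesis by (intro that[of n]) (simp add: mult_ac)
  qed
  \<comment> \<open>The factor \<open>\<kappa> ^ n0\<close> leaves room for at least
    \<open>n0\<close> letters after \<open>I\<close> before the old steps reach the size of the new
    one.\<close>
  define \<eta> where "\<eta> = \<kappa> ^ n0 * ?D"
  have eta: "\<eta> > 0" using kappa D by (simp add: \<eta>_def)
  obtain I J where I: "I \<in> W" and J: "J \<in> W"
    and small: "\<And>x. x \<in> X \<Longrightarrow> norm (f I x - f J x) \<le> \<eta> * sv1 (M I)"
    and differ: "\<exists>x\<in>X. f I x \<noteq> f J x"
    using small_displacement[OF posc eta] by metis
  define d where "d z = f I z - f J z" for z
  have d_affine: "d x - d y = (M I - M J) *v (x - y)" for x y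
  proof -
    have "d x - d y = (f I x - f I y) - (f J x - f J y)" by (simp add: d_def)
    then show ?thesis by (simp add: word_map_diff matrix_vector_mult_diff_rdistrib)
  qed
  have "continuous_on X (\<lambda>z. norm (d z))"
  proof -
    have "d z = (M I - M J) *v z + d 0" for z using d_affine[of z 0] by (simp add: algebra_simps)
    then have "d = (\<lambda>z. (M I - M J) *v z + d 0)" by blast
    moreover have "continuous_on X (\<lambda>z. norm ((M I - M J) *v z + d 0))"
      by (intro continuous_intros linear_continuous_on) simp
    ultimately show ?thesis by metis
  qed
  then obtain y where y: "y \<in> X" "\<And>z. z \<in> X \<Longrightarrow> norm (d z) \<le> norm (d y)"
    using continuous_attains_sup[OF X_compact X_nonempty] by metis
  define S where "S = norm (d y)"
  have S: "S > 0"
  proof -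
    obtain z where "z \<in> X" "d z \<noteq> 0" using differ by (auto simp: d_def)
    then show ?thesis using y(2)[of z] unfolding S_def by (meson less_le_trans zero_less_norm_iff)
  qed
  have "S \<le> \<eta> * sv1 (M I)" using small[OF y(1)] by (simp add: S_def d_def)
  then have "S / ?D \<le> \<kappa> ^ n0 * sv1 (M I)"
    using D by (simp add: \<eta>_def pos_divide_le_eq mult_ac)
  then obtain w where w: "w \<in> W" "n0 \<le> length w" "y \<in> f w ` X"
    and match: "S / ?D \<le> sv1 (M (I @ w))" "\<kappa> * sv1 (M (I @ w)) \<le> S / ?D"
    using prefix_match[OF y(1) I] S D by (metis divide_pos_pos)
  let ?\<nu> = "sv1 (M (I @ w))"
  have nu: "S \<le> ?\<nu> * ?D" "\<kappa> * (?\<nu> * ?D) \<le> S"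
    using match D by (simp_all add: pos_divide_le_eq pos_le_divide_eq mult.assoc)
  have Iw: "I @ w \<in> W" using I w by simp
  have d_near: "norm (d (f (w @ k1) z) - d y) \<le> \<delta> * S" if z: "z \<in> X" for z
  proof -
    obtain y' where y': "y' \<in> X" "y = f w y'" using w(3) by blast
    have "norm (f (w @ k1) z - y) \<le> \<rho> ^ length w * norm (f k1 z - y')"
      unfolding y' word_map_append comp_apply by (rule word_map_lipschitz[OF w(1)])
    also have "\<dots> \<le> \<rho> ^ n0 * ?\<Delta>"
      using w(2) rho norm_diff_le_diameter[OF word_map_in[OF k1(1) z] y'(1)]
      by (intro mult_mono power_decreasing) auto
    finally have "K * S * norm (f (w @ k1) z - y) \<le> K * S * (\<rho> ^ n0 * ?\<Delta>)"
      using K(1) S by (intro mult_left_mono) auto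
    also have "\<dots> = S * (K * (\<rho> ^ n0 * ?\<Delta>))" by simp
    also have "\<dots> \<le> S * \<delta>" using n0 S by (intro mult_left_mono) auto
    finally have "K * S * norm (f (w @ k1) z - y) \<le> \<delta> * S" by (simp add: mult.commute)
    moreover have "f (w @ k1) z \<in> X" using w(1) k1(1) z by (intro word_map_in) auto
    ultimately show ?thesis
      using K(2)[OF d_affine, of S "f (w @ k1) z" y] y S_def by fastforce
  qed
  define E where "E = M (I @ w @ k1) *v a"
  have E: "c * (?\<nu> * ?D) \<le> norm E" "norm E \<le> ?\<nu> * ?D"
  proof -
    show "c * (?\<nu> * ?D) \<le> norm E" using k1(2)[OF Iw] by (simp add: E_def mult_ac)
    have "E = M (I @ w) *v (M k1 *v a)"
      by (simp add: E_def word_mat_append matrix_vector_mul_assoc matrix_mul_assoc)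
    then have "norm E \<le> ?\<nu> * norm (M k1 *v a)" using norm_mult_le_sv1 by metis
    also have "\<dots> \<le> ?\<nu> * ?D" using norm_word_le_norm[OF k1(1)] by (intro mult_left_mono) auto
    finally show "norm E \<le> ?\<nu> * ?D" .
  qed
  \<comment> \<open>Here the suffix must serve two different vectors: \<open>d y\<close>, which
    becomes the new step, and \<open>E\<close>, the direction of the old ones.\<close>
  obtain k where k: "k \<in> W" "\<And>i. i \<in> W \<Longrightarrow> c * sv1 (M i) * S \<le> norm (M (i @ k) *v d y)"
    "\<And>i. i \<in> W \<Longrightarrow> c * sv1 (M i) * norm E \<le> norm (M (i @ k) *v E)"
    using suffix[of "d y" E] unfolding S_def by blast
  \<comment> \<open>The bound \<open>c / 2\<close> is the thinness required by
    \<open>nearly_parallel_images\<close>. The other entry makes the alignment error at most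
    \<open>\<delta>\<close>, for the tolerance, and at most \<open>c / 2\<close>, so that
    \<open>s\<close> stays away from 0.\<close>
  define \<theta> where "\<theta> = min (c / 2) (min \<delta> (c / 2) / (1 + 2 / c))"
  have c1: "1 + 2 / c > 0" using c by (simp add: add_pos_pos)
  have theta: "\<theta> > 0" "\<theta> \<le> c / 2" "\<theta> * (1 + 2 / c) \<le> \<delta>" "\<theta> * (1 + 2 / c) \<le> c / 2"
  proof -
    show "\<theta> > 0" using c c1 delta by (simp add: \<theta>_def)
    show "\<theta> \<le> c / 2" unfolding \<theta>_def by (rule min.cobounded1)
    have "\<theta> \<le> min \<delta> (c / 2) / (1 + 2 / c)" unfolding \<theta>_def by (rule min.cobounded2)
    then have "\<theta> * (1 + 2 / c) \<le> min \<delta> (c / 2)" using c1 by (simp only: pos_le_divide_eq)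
    then show "\<theta> * (1 + 2 / c) \<le> \<delta>" "\<theta> * (1 + 2 / c) \<le> c / 2" by simp_all
  qed
  obtain q where q: "q \<in> W" "sv2 (M q) \<le> \<theta> * sv1 (M q)"
    using thin_word[OF theta(1)] two_maps by auto
  let ?q = "sv1 (M q)"
  have qpos: "?q > 0" by (rule sv1_word_pos[OF q(1)])
  define P where "P = M (q @ k)"
  have P: "P *v z = M q *v (M k *v z)" for z
    by (simp add: P_def word_mat_append matrix_vector_mul_assoc)
  have Ple: "norm (P *v z) \<le> ?q * norm z" for z
    using norm_mult_le_sv1[of "M q" "M k *v z"] mult_left_mono[OF norm_word_le_norm[OF k(1), of z], of ?q]
    unfolding P by simp
  define a' where "a' = P *v E"
  have a'lo: "c\<^sup>2 * ?q * (?\<nu> * ?D) \<le> norm a'"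
  proof -
    have "c * ?q * (c * (?\<nu> * ?D)) \<le> c * ?q * norm E" using E(1) c by (intro mult_left_mono) auto
    also have "\<dots> \<le> norm a'" using k(3)[OF q(1)] by (simp add: a'_def P_def)
    finally show ?thesis by (simp add: power2_eq_square mult_ac)
  qed
  have a'hi: "norm a' \<le> ?q * (?\<nu> * ?D)"
    using Ple[of E] mult_left_mono[OF E(2), of ?q] by (simp add: a'_def)
  have a'S: "c\<^sup>2 * ?q * S \<le> norm a'"
    using mult_left_mono[OF nu(1), of "c\<^sup>2 * ?q"] a'lo by simp
  have "c\<^sup>2 * ?q * S > 0" using c qpos S by simp
  then have a'pos: "norm a' > 0" using a'S by linarith
  then have a'0: "a' \<noteq> 0" by simp
  have Ek: "M k *v E \<noteq> 0" using a'0 by (auto simp: a'_def P)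
  obtain s where s: "norm (P *v d y - s *\<^sub>R a') \<le> sv2 (M q) * (1 + 2 / c) * norm (M k *v d y)"
  proof -
    have "c * ?q * norm (M k *v E) \<le> norm (M q *v (M k *v E))"
    proof -
      have "c * ?q * norm (M k *v E) \<le> c * ?q * norm E"
        using norm_word_le_norm[OF k(1)] c by (intro mult_left_mono) auto
      also have "\<dots> \<le> norm (M q *v (M k *v E))" using k(3)[OF q(1)] by (simp add: P[symmetric] P_def)
      finally show ?thesis .
    qed
    moreover have "sv2 (M q) \<le> c / 2 * ?q"
      using q(2) mult_right_mono[OF theta(2), of ?q] by simp
    ultimately show ?thesis
      using nearly_parallel_images[OF c(1) qpos _ Ek, of "M k *v d y"] that unfolding a'_def P by blast
  qed
  have err: "norm (P *v d y - s *\<^sub>R a') \<le> \<theta> * (1 + 2 / c) * (?q * S)"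
  proof -
    have "sv2 (M q) * (1 + 2 / c) * norm (M k *v d y) \<le> (\<theta> * ?q) * (1 + 2 / c) * S"
      using q(2) c1 theta(1) norm_word_le_norm[OF k(1), of "d y"] unfolding S_def
      by (intro mult_mono) auto
    then show ?thesis using s by (simp add: mult_ac)
  qed
  have err_c: "norm (P *v d y - s *\<^sub>R a') \<le> c / 2 * (?q * S)"
    by (rule order_trans[OF err mult_right_mono[OF theta(4)]]) (use S in simp)
  have err_d: "norm (P *v d y - s *\<^sub>R a') \<le> \<delta> * (?q * S)"
    by (rule order_trans[OF err mult_right_mono[OF theta(3)]]) (use S in simp)
  \<comment> \<open>Half of the guaranteed length \<open>c * (?q * S)\<close> survives the error,
    and \<open>\<kappa>\<close> is the overshoot allowed by the prefix \<open>w\<close>; this is the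
    origin of the lower step bound.\<close>
  have s_lo: "c * \<kappa> / 2 \<le> \<bar>s\<bar>"
  proof -
    have "c * (?q * S) \<le> norm (P *v d y)" using k(2)[OF q(1)] by (simp add: P_def mult_ac)
    then have "c / 2 * (?q * S) \<le> \<bar>s\<bar> * norm a'"
      using err_c norm_triangle_ineq2[of "P *v d y" "s *\<^sub>R a'"] by simp
    also have "\<dots> \<le> \<bar>s\<bar> * (?q * (?\<nu> * ?D))" using a'hi by (intro mult_left_mono) auto
    finally have "c / 2 * (?q * S) \<le> \<bar>s\<bar> * (?q * (?\<nu> * ?D))" .
    moreover have "c / 2 * (?q * (\<kappa> * (?\<nu> * ?D))) \<le> c / 2 * (?q * S)"
      using nu(2) c qpos by (intro mult_left_mono) auto
    ultimately have "c * \<kappa> / 2 * (?q * (?\<nu> * ?D)) \<le> \<bar>s\<bar> * (?q * (?\<nu> * ?D))" by (simp add: mult_ac)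
    moreover have "?q * (?\<nu> * ?D) > 0" using a'pos a'hi by linarith
    ultimately show ?thesis by (simp only: mult_le_cancel_right_pos)
  qed
  \<comment> \<open>The new step has length at most \<open>2 * (?q * S)\<close> up to direction,
    while the suffixes \<open>k1\<close> and \<open>k\<close> guarantee
    \<open>c\<^sup>2 * ?q * S \<le> norm a'\<close>.\<close>
  have s_hi: "\<bar>s\<bar> \<le> 2 / c\<^sup>2"
  proof -
    have "\<bar>s\<bar> * norm a' \<le> norm (P *v d y) + c / 2 * (?q * S)"
      using err_c norm_triangle_ineq2[of "s *\<^sub>R a'" "P *v d y"] by (simp add: norm_minus_commute)
    also have "\<dots> \<le> ?q * S + 1 * (?q * S)"
      using Ple[of "d y"] c qpos S unfolding S_def by (intro add_mono mult_right_mono) auto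
    finally have "\<bar>s\<bar> * norm a' \<le> 2 * (?q * S)" by (simp add: mult.commute)
    moreover have "\<bar>s\<bar> * (c\<^sup>2 * ?q * S) \<le> \<bar>s\<bar> * norm a'" using a'S by (intro mult_left_mono) auto
    ultimately have "(\<bar>s\<bar> * c\<^sup>2) * (?q * S) \<le> 2 * (?q * S)" by (simp add: mult_ac)
    moreover have "?q * S > 0" using qpos S by simp
    ultimately have "\<bar>s\<bar> * c\<^sup>2 \<le> 2" by (simp only: mult_le_cancel_right_pos)
    then show ?thesis using c by (simp add: pos_le_divide_eq)
  qed
  have new: "norm (P *v d (f (w @ k1) z) - s *\<^sub>R a') \<le> \<epsilon> * norm a'" if z: "z \<in> X" for z
  proof -
    have "norm (P *v (d (f (w @ k1) z) - d y)) \<le> \<delta> * (?q * S)"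
      using order_trans[OF Ple[of "d (f (w @ k1) z) - d y"] mult_left_mono[OF d_near[OF z]]] qpos
      by (simp add: mult_ac)
    then have "norm (P *v d (f (w @ k1) z) - s *\<^sub>R a') \<le> \<delta> * (?q * S) + \<delta> * (?q * S)"
      using norm_triangle_mono[OF _ err_d, of "P *v (d (f (w @ k1) z) - d y)"]
      by (simp only: matrix_vector_mult_diff_distrib diff_add_cancel add_diff_eq)
    also have "\<dots> = \<epsilon> * (c\<^sup>2 * ?q * S)" by (simp add: \<delta>_def)
    also have "\<dots> \<le> \<epsilon> * norm a'" using a'S eps by (intro mult_left_mono) auto
    finally show ?thesis .
  qed
  let ?Q = "(q @ k) @ I @ w @ k1" and ?R = "(q @ k) @ J @ w @ k1"
  have QR: "?Q \<in> W" "?R \<in> W" using q k I J w k1 by auto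
  \<comment> \<open>The map may stretch the errors by \<open>?q * ?\<nu>\<close> but is only
    guaranteed to stretch \<open>a\<close> by \<open>c\<^sup>2\<close> times that; the tolerance
    \<open>c\<^sup>2 * \<epsilon>\<close> of the given walk compensates exactly for this.\<close>
  have old: "walk X (c * \<kappa> / 2) (2 / c\<^sup>2) m \<epsilon> (\<lambda>l. f ?Q (x l)) a' t"
    unfolding walk_def
  proof (intro conjI allI impI)
    show "a' \<noteq> 0" by (rule a'0)
    show "f ?Q (x l) \<in> X" if "l \<le> m" for l using QR(1) xX[OF that] by (rule word_map_in)
    fix l assume l: "l < m"
    show "c * \<kappa> / 2 \<le> t l" "t l \<le> 2 / c\<^sup>2" using tl[OF l] by auto
    have Qz: "M ?Q *v z = P *v (M (I @ w) *v (M k1 *v z))" for z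
      by (simp add: P_def word_mat_append matrix_vector_mul_assoc matrix_mul_assoc)
    have Qle: "norm (M ?Q *v z) \<le> ?q * (?\<nu> * norm z)" for z
    proof -
      have "norm (M ?Q *v z) \<le> ?q * norm (M (I @ w) *v (M k1 *v z))" unfolding Qz by (rule Ple)
      also have "\<dots> \<le> ?q * (?\<nu> * norm (M k1 *v z))" by (intro mult_left_mono norm_mult_le_sv1) simp
      also have "\<dots> \<le> ?q * (?\<nu> * norm z)" using norm_word_le_norm[OF k1(1)] by (intro mult_left_mono) auto
      finally show ?thesis .
    qed
    have "M ?Q *v a = a'"
      by (simp add: a'_def E_def P_def word_mat_append matrix_vector_mul_assoc matrix_mul_assoc)
    then have "f ?Q (x (Suc l)) - f ?Q (x l) - t l *\<^sub>R a' = M ?Q *v (x (Suc l) - x l - t l *\<^sub>R a)"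
      by (simp only: word_map_diff matrix_vector_mult_diff_distrib matrix_vector_mult_scaleR)
    also have "norm \<dots> \<le> ?q * (?\<nu> * (c\<^sup>2 * \<epsilon> * ?D))"
      by (rule order_trans[OF Qle]) (intro mult_left_mono gap l; simp)
    also have "\<dots> = \<epsilon> * (c\<^sup>2 * ?q * (?\<nu> * ?D))" by simp
    also have "\<dots> \<le> \<epsilon> * norm a'" using a'lo eps by (intro mult_left_mono) auto
    finally show "norm (f ?Q (x (Suc l)) - f ?Q (x l) - t l *\<^sub>R a') \<le> \<epsilon> * norm a'" .
  qed
  have jump: "f ?Q z - f ?R z = P *v d (f (w @ k1) z)" for z
    unfolding word_map_append[of A v "q @ k"] comp_apply word_map_diff P_def d_def
    by (simp add: word_map_append)
  have Rin: "f ?R z \<in> X" if "z \<in> X" for z using QR(2) that by (rule word_map_in)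
  \<comment> \<open>The sign of \<open>s\<close> cannot be prescribed. As
    \<open>f ?Q z - f ?R z\<close> is close to \<open>s *\<^sub>R a'\<close>, the new point goes
    before the first one if \<open>s \<ge> 0\<close> and after the last one otherwise.\<close>
  show ?thesis
  proof (cases "s \<ge> 0")
    case True
    have "norm (f ?Q (x 0) - f ?R (x 0) - \<bar>s\<bar> *\<^sub>R a') \<le> \<epsilon> * norm a'"
      using new[OF xX[of 0]] True unfolding jump by simp
    then show ?thesis using walk_prepend[OF old Rin[OF xX[of 0]] s_lo s_hi] by blast
  next
    case False
    have "f ?R (x m) - f ?Q (x m) - \<bar>s\<bar> *\<^sub>R a' = - (P *v d (f (w @ k1) (x m)) - s *\<^sub>R a')"
      using jump[of "x m"] False by (simp add: algebra_simps)
    then have "norm (f ?R (x m) - f ?Q (x m) - \<bar>s\<bar> *\<^sub>R a') \<le> \<epsilon> * norm a'"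
      using new[OF xX[of m]] by (metis norm_minus_cancel order_refl)
    then show ?thesis using walk_append[OF old Rin[OF xX[of m]] s_lo s_hi] by blast
  qed
qed

end

section \<open>Covering numbers\<close>

text \<open>One point is chosen in each occupied cell of a grid of side \<open>r / 2\<close>. Each
  axis meets at most \<open>4 * (R / r) + 2\<close> intervals, which is at most
  \<open>6 * (R / r)\<close>. The bound makes 2 an admissible exponent.\<close>

lemma planar_covering:
  fixes Y :: "vec2 set"
  assumes "0 < r" "r < R"
  shows "\<exists>F. finite F \<and> F \<subseteq> Y \<and> real (card F) \<le> 36 * (R / r) powr 2 \<and>
           Y \<inter> cball x R \<subseteq> (\<Union>y\<in>F. cball y r)"
proof -
  define h where "h = r / 2"
  have h: "h > 0" using assms by (simp add: h_def)
  let ?S = "Y \<inter> cball x R"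
  define g where "g y = (\<lfloor>y $ 1 / h\<rfloor>, \<lfloor>y $ 2 / h\<rfloor>)" for y :: vec2
  let ?I = "\<lambda>i. {\<lfloor>(x $ i - R) / h\<rfloor>..\<lfloor>(x $ i + R) / h\<rfloor>}"
  have sub: "g ` ?S \<subseteq> ?I 1 \<times> ?I 2"
  proof
    fix p assume "p \<in> g ` ?S"
    then obtain y where y: "y \<in> cball x R" "p = g y" by blast
    have "\<bar>y $ i - x $ i\<bar> \<le> R" for i
      using component_le_norm_cart[of "y - x" i] y(1) by (simp add: dist_norm norm_minus_commute)
    then have "x $ i - R \<le> y $ i \<and> y $ i \<le> x $ i + R" for i by (simp add: abs_le_iff) (smt (verit))
    then have "\<lfloor>y $ i / h\<rfloor> \<in> ?I i" for i
      using h by (auto intro!: floor_mono divide_right_mono)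
    then show "p \<in> ?I 1 \<times> ?I 2" using y by (simp add: g_def)
  qed
  have fin: "finite (g ` ?S)" by (rule finite_subset[OF sub]) simp
  have cardI: "real (card (?I i)) \<le> 6 * (R / r)" for i
  proof -
    have "(x $ i + R) / h - (x $ i - R) / h = 4 * (R / r)"
      using assms by (simp add: h_def field_simps)
    moreover have "1 \<le> R / r" using assms by simp
    moreover have "real_of_int \<lfloor>(x $ i + R) / h\<rfloor> \<le> (x $ i + R) / h"
      "(x $ i - R) / h - 1 < real_of_int \<lfloor>(x $ i - R) / h\<rfloor>" by linarith+
    ultimately have "real_of_int (\<lfloor>(x $ i + R) / h\<rfloor> + 1 - \<lfloor>(x $ i - R) / h\<rfloor>) \<le> 6 * (R / r)"
      by (simp only: of_int_diff of_int_add of_int_1)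
    moreover have "0 \<le> 6 * (R / r)" using assms by simp
    ultimately show ?thesis by (simp add: of_nat_nat max_def) 
  qed
  let ?F = "inv_into ?S g ` g ` ?S"
  have "real (card ?F) \<le> real (card (g ` ?S))"
    using card_image_le[OF fin] by simp
  also have "\<dots> \<le> real (card (?I 1 \<times> ?I 2))"
    unfolding of_nat_le_iff by (rule card_mono[OF _ sub]) simp
  also have "\<dots> \<le> (6 * (R / r)) * (6 * (R / r))"
    using cardI[of 1] cardI[of 2] unfolding card_cartesian_product of_nat_mult
    by (intro mult_mono) auto
  also have "\<dots> = 36 * (R / r) powr 2"
    using assms by (simp add: power2_eq_square)
  finally have card: "real (card ?F) \<le> 36 * (R / r) powr 2" .
  have F: "?F \<subseteq> ?S" 
  proof
    fix p assume "p \<in> ?F"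
    then obtain b where "b \<in> g ` ?S" "p = inv_into ?S g b" by blast
    then show "p \<in> ?S" by (simp only: inv_into_into)
  qed
  have "?S \<subseteq> (\<Union>y\<in>?F. cball y r)"
  proof
    fix y assume y: "y \<in> ?S"
    let ?y = "inv_into ?S g (g y)"
    have "g ?y = g y" using y by (intro f_inv_into_f) auto
    then have eq: "\<lfloor>?y $ 1 / h\<rfloor> = \<lfloor>y $ 1 / h\<rfloor>" "\<lfloor>?y $ 2 / h\<rfloor> = \<lfloor>y $ 2 / h\<rfloor>" by (simp_all add: g_def)
    have close: "\<bar>a - b\<bar> \<le> h" if "\<lfloor>a / h\<rfloor> = \<lfloor>b / h\<rfloor>" for a b
    proof -
      have "\<bar>a / h - b / h\<bar> \<le> 1" using that by linarith
      then have "\<bar>(a - b) / h\<bar> \<le> 1" by (simp add: diff_divide_distrib)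
      then show ?thesis using h by (simp add: abs_divide)
    qed
    have "norm (?y - y) \<le> \<bar>(?y - y) $ 1\<bar> + \<bar>(?y - y) $ 2\<bar>"
      using norm_le_l1_cart[of "?y - y"] by (simp add: sum_2)
    also have "\<dots> \<le> h + h" using close[OF eq(1)] close[OF eq(2)] by simp
    finally have "y \<in> cball ?y r" by (simp add: dist_norm h_def)
    then show "y \<in> (\<Union>y\<in>?F. cball y r)" using y by blast
  qed
  then show ?thesis using card F fin by (intro exI[of _ ?F]) auto
qed

lemma linear_le_powr_imp_ge_1:
  assumes "\<And>n. 1 \<le> n \<Longrightarrow> real n \<le> B * real n powr s"
  shows "1 \<le> s"
proof (rule ccontr)
  assume "\<not> 1 \<le> s"
  then have s: "1 - s > 0" by simp
  have B: "1 \<le> B" using assms[of 1] by simp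
  let ?b = "(B + 1) powr (1 / (1 - s))"
  obtain n where n: "?b \<le> real n" using real_arch_simple by blast
  have "?b > 0" using B by simp
  then have npos: "real n > 0" using n by linarith
  have "B + 1 = ?b powr (1 - s)" using B s by (simp add: powr_powr)
  also have "\<dots> \<le> real n powr (1 - s)" using n s by (intro powr_mono2) auto
  also have "\<dots> = real n / real n powr s" using npos by (simp add: powr_diff)
  also have "\<dots> \<le> B" using assms[of n] npos by (simp add: divide_le_eq)
  finally show False by simp
qed

text \<open>With tolerance \<open>r / 2\<close>, the inner product with \<open>a\<close> grows by at
  least half of the smallest step at each point, so no two points of the walk come close even if
  they are not consecutive.\<close>

lemma walks_imp_assouad_exponent_ge_1:
  assumes r: "0 < r" "0 \<le> R" and walks: "\<And>m. \<exists>x a t. walk X r R m (r / 2) x a t"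
    and cover: "\<And>x \<rho> P. \<lbrakk>x \<in> X; 0 < \<rho>; \<rho> < P\<rbrakk> \<Longrightarrow> \<exists>F. finite F \<and> F \<subseteq> X \<and> real (card F) \<le> C * (P / \<rho>) powr s \<and>
           X \<inter> cball x P \<subseteq> (\<Union>y\<in>F. cball y \<rho>)"
  shows "1 \<le> s"
proof (rule linear_le_powr_imp_ge_1)
  let ?L = "6 * (R + r) / r"
  fix n :: nat assume "1 \<le> n"
  then obtain m where n: "n = Suc m" by (cases n) auto
  obtain x a t where a: "a \<noteq> 0" and X: "\<And>l. l \<le> m \<Longrightarrow> x l \<in> X"
    and t: "\<And>l. l < m \<Longrightarrow> r \<le> t l" "\<And>l. l < m \<Longrightarrow> t l \<le> R"
    and gap: "\<And>l. l < m \<Longrightarrow> norm (x (Suc l) - x l - t l *\<^sub>R a) \<le> r / 2 * norm a"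
    using walks[of m] unfolding walk_def by blast
  let ?D = "norm a"
  have D: "?D > 0" using a by simp
  have step: "r / 2 * ?D\<^sup>2 \<le> a \<bullet> x (Suc l) - a \<bullet> x l" if l: "l < m" for l
  proof -
    have "\<bar>a \<bullet> (x (Suc l) - x l - t l *\<^sub>R a)\<bar> \<le> ?D * (r / 2 * ?D)"
      by (rule order_trans[OF Cauchy_Schwarz_ineq2]) (intro mult_left_mono gap l; simp)
    moreover have "r * ?D\<^sup>2 \<le> t l * ?D\<^sup>2" using t(1)[OF l] by (intro mult_right_mono) auto
    moreover have "a \<bullet> (x (Suc l) - x l - t l *\<^sub>R a) = a \<bullet> x (Suc l) - a \<bullet> x l - t l * ?D\<^sup>2"
      by (simp add: inner_diff_right dot_square_norm)
    moreover have "?D * (r / 2 * ?D) = r / 2 * ?D\<^sup>2" by (simp add: power2_eq_square)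
    ultimately show ?thesis by linarith
  qed
  have mono: "r / 2 * ?D\<^sup>2 \<le> a \<bullet> x j - a \<bullet> x i" if "i < j" "j \<le> m" for i j
    using that
  proof (induction j)
    case (Suc j)
    have pos: "0 \<le> r / 2 * ?D\<^sup>2" using r by simp
    show ?case
    proof (cases "i = j")
      case True
      then show ?thesis using step[of j] Suc.prems by simp
    next
      case False
      then show ?thesis using Suc step[of j] pos by simp
    qed
  qed simp
  have far: "r / 2 * ?D \<le> norm (x j - x i)" if "i < j" "j \<le> m" for i j
  proof -
    have "?D * (r / 2 * ?D) \<le> a \<bullet> (x j - x i)"
      using mono[OF that] by (simp add: inner_diff_right power2_eq_square mult_ac)
    also have "\<dots> \<le> ?D * norm (x j - x i)" using norm_cauchy_schwarz by blast
    finally show ?thesis using D by (simp only: mult_le_cancel_left_pos)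
  qed
  have near: "norm (x l - x 0) \<le> real l * ((R + r) * ?D)" if "l \<le> m" for l using that
  proof (induction l)
    case (Suc l)
    have "norm (x (Suc l) - x l) \<le> norm (x (Suc l) - x l - t l *\<^sub>R a) + norm (t l *\<^sub>R a)"
      using norm_triangle_ineq[of "x (Suc l) - x l - t l *\<^sub>R a" "t l *\<^sub>R a"] by simp
    also have "\<dots> \<le> r / 2 * ?D + R * ?D"
      using gap[of l] t[of l] r Suc.prems by (auto intro!: add_mono mult_right_mono)
    also have "\<dots> \<le> (R + r) * ?D" using r D by (simp add: algebra_simps)
    finally have "norm (x (Suc l) - x l) \<le> (R + r) * ?D" .
    moreover have "norm (x l - x 0) \<le> real l * ((R + r) * ?D)" using Suc by simp
    ultimately have "norm (x (Suc l) - x 0) \<le> (R + r) * ?D + real l * ((R + r) * ?D)"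
      using norm_triangle_ineq[of "x (Suc l) - x l" "x l - x 0"] by simp
    then show ?case by (simp add: algebra_simps)
  qed simp
  \<comment> \<open>A ball of this radius has diameter at most \<open>r / 3 * ?D\<close>, below the
    separation \<open>r / 2 * ?D\<close>, so it contains at most one point of the walk.\<close>
  let ?\<rho> = "r / 6 * ?D" and ?P = "real n * ((R + r) * ?D)"
  have rho: "0 < ?\<rho>" using r D by simp
  have "?\<rho> < (R + r) * ?D" using r D by (intro mult_strict_right_mono) auto
  also have "\<dots> \<le> ?P" using mult_right_mono[of 1 "real n" "(R + r) * ?D"] r n by simp
  finally have rhoP: "?\<rho> < ?P" .
  obtain F where F: "finite F" "real (card F) \<le> C * (?P / ?\<rho>) powr s"
    "X \<inter> cball (x 0) ?P \<subseteq> (\<Union>y\<in>F. cball y ?\<rho>)"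
    using cover[OF X[of 0] rho rhoP] by blast
  have "\<exists>y\<in>F. x l \<in> cball y ?\<rho>" if "l \<le> m" for l
  proof -
    have "real l * ((R + r) * ?D) \<le> ?P" using that n r by (intro mult_right_mono) auto
    then have "x l \<in> X \<inter> cball (x 0) ?P"
      using near[OF that] X[OF that] by (simp add: dist_norm norm_minus_commute)
    then show ?thesis using F(3) by blast
  qed
  then obtain y where y: "\<And>l. l \<le> m \<Longrightarrow> y l \<in> F" "\<And>l. l \<le> m \<Longrightarrow> x l \<in> cball (y l) ?\<rho>" by metis
  have apart: "y i \<noteq> y j" if "i < j" "j \<le> m" for i j
  proof
    assume "y i = y j"
    then have "dist (x j) (x i) \<le> ?\<rho> + ?\<rho>"
      using y(2)[of i] y(2)[of j] that dist_triangle2[of "x j" "x i" "y j"]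
      by (simp add: dist_commute)
    then have "r / 2 * ?D \<le> r / 3 * ?D" using far[OF that] by (simp add: dist_norm)
    then show False using r D by simp
  qed
  have "inj_on y {..m}"
    by (rule inj_onI) (metis apart atMost_iff linorder_neqE_nat)
  then have "card {..m} \<le> card F" using y(1) F(1) by (intro card_inj_on_le[of y]) auto
  then have "real n \<le> C * (?P / ?\<rho>) powr s" using F(2) n by simp
  also have "?P / ?\<rho> = ?L * real n" using r D by (simp add: field_simps)
  also have "(?L * real n) powr s = ?L powr s * real n powr s"
    by (rule powr_mult)
  finally show "real n \<le> (C * ?L powr s) * real n powr s" by simp
qed

section \<open>Uniform constants and the induction on the length of walks\<close>

theorem mainTheorem7:
  fixes N :: nat and A :: "nat \<Rightarrow> real^2^2" and v :: "nat \<Rightarrow> real^2" and X :: "(real^2) set"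
  assumes "self_affine_set N A v X"
    and "dominated N A"
    and "strong_separation N A v X"
    and "\<not> proj_open_set_condition N A v X"
    and "\<not> (\<exists>V. furstenberg_dirs N A = {V})"
  shows "assouad_dim X \<ge> 1"
proof -
  have ifs: "2 \<le> N" "\<And>i. i < N \<Longrightarrow> invertible (A i)" "\<And>i. i < N \<Longrightarrow> sv1 (A i) < 1"
    and X: "X \<noteq> {}" "compact X" "X = (\<Union>i<N. aff A v i ` X)"
    using assms(1) unfolding self_affine_set_def affine_IFS_def by auto
  have fin: "finite (g ` {..<N})" "g ` {..<N} \<noteq> {}" for g :: "nat \<Rightarrow> real"
    using ifs(1) by (auto simp: lessThan_empty_iff)
  define \<kappa> where "\<kappa> = min 1 (Min ((\<lambda>i. sv2 (A i)) ` {..<N}))"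
  have kappa: "0 < \<kappa>" "\<kappa> \<le> 1" "\<And>i. i < N \<Longrightarrow> \<kappa> \<le> sv2 (A i)"
    using fin[of "\<lambda>i. sv2 (A i)"] sv2_pos ifs(2) by (auto simp: \<kappa>_def intro!: min.coboundedI2)
  define \<rho> where "\<rho> = max (1 / 2) (Max ((\<lambda>i. sv1 (A i)) ` {..<N}))"
  have rho: "0 < \<rho>" "\<rho> < 1" "\<And>i. i < N \<Longrightarrow> sv1 (A i) \<le> \<rho>"
    using fin[of "\<lambda>i. sv1 (A i)"] ifs(3) by (auto simp: \<rho>_def intro!: max.coboundedI2)
  obtain C \<tau> where dom: "0 < C" "0 < \<tau>" "\<tau> < 1"
    "\<And>w. w \<in> lists {..<N} \<Longrightarrow> sv2 (word_mat A w) \<le> C * \<tau> ^ length w * sv1 (word_mat A w)"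
    using assms(2) unfolding dominated_def by blast
  interpret dominated_self_affine N A \<kappa> \<rho> C \<tau> v X
  proof unfold_locales
    show "\<kappa> * norm z \<le> norm (A i *v z)" if "i < N" for i z
      using mult_right_mono[OF kappa(3)[OF that] norm_ge_zero] sv2_mult_le by (rule order_trans)
    show "norm (A i *v z) \<le> \<rho> * norm z" if "i < N" for i z
      using norm_mult_le_sv1 mult_right_mono[OF rho(3)[OF that] norm_ge_zero] by (rule order_trans)
  qed (use kappa rho dom ifs X assms(3) in auto)
  obtain V1 V2 where V: "V1 \<in> furstenberg_dirs N A" "V2 \<in> furstenberg_dirs N A" "V1 \<noteq> V2"
  proof -
    \<comment> \<open>Without any Furstenberg direction the projective open set condition would hold
      vacuously. Hence not being a singleton means having two directions.\<close>
    have "furstenberg_dirs N A \<noteq> {}"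
      using assms(4) unfolding proj_open_set_condition_def by (metis empty_iff zero_less_one)
    then show ?thesis using assms(5) that by blast
  qed
  obtain u1 where u1: "limit_row N A u1" "V1 = {z. u1 \<bullet> z = 0}" using furstenberg_limit_row[OF V(1)] .
  obtain u2 where u2: "limit_row N A u2" "V2 = {z. u2 \<bullet> z = 0}" using furstenberg_limit_row[OF V(2)] .
  have cross: "crossp u1 u2 \<noteq> 0"
  proof
    assume "crossp u1 u2 = 0"
    moreover have "u1 \<noteq> 0" "u2 \<noteq> 0" using u1 u2 by (auto simp: limit_row_def)
    ultimately obtain l where "u2 = l *\<^sub>R u1" "l \<noteq> 0" using crossp_eq_0_imp_parallel by (metis scale_zero_left)
    then show False using u1(2) u2(2) V(3) by simp
  qed
  obtain u3 where u3: "limit_row N A u3" "crossp u1 u3 \<noteq> 0" "crossp u2 u3 \<noteq> 0"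
    using third_limit_row[OF u1(1) u2(1) cross] .
  obtain c where c: "0 < c" "c \<le> 1" and suffix:
    "\<And>E F. \<exists>k\<in>W. \<forall>i\<in>W. c * sv1 (M i) * norm E \<le> norm (M (i @ k) *v E) \<and>
       c * sv1 (M i) * norm F \<le> norm (M (i @ k) *v F)"
    using good_suffix[OF u1(1) u2(1) u3(1) cross u3(2,3)] by blast
  let ?r = "c * \<kappa> / 2" and ?R = "2 / c\<^sup>2"
  have walks: "\<epsilon> > 0 \<Longrightarrow> \<exists>x a t. walk X ?r ?R m \<epsilon> x a t" for m \<epsilon>
  proof (induction m arbitrary: \<epsilon>)
    case 0
    obtain p where "p \<in> X" using X(1) by blast
    then have "walk X ?r ?R 0 \<epsilon> (\<lambda>_. p) (axis 1 1) (\<lambda>_. 0)" by (simp add: walk_def axis_eq_0_iff)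
    then show ?case by blast
  next
    case (Suc m)
    have "c\<^sup>2 * \<epsilon> > 0" using c Suc.prems by simp
    then show ?case using walk_extend[OF c suffix assms(4) Suc.prems] Suc.IH by metis
  qed
  show ?thesis unfolding assouad_dim_def
  proof (rule cInf_greatest, goal_cases)
    case 1
    \<comment> \<open>A lower bound for all admissible exponents bounds their infimum only if there
      is at least one.\<close>
    have "2 \<in> {s. s \<ge> 0 \<and> (\<exists>C. \<forall>x\<in>X. \<forall>r R. 0 < r \<and> r < R \<longrightarrow>
      (\<exists>F. finite F \<and> F \<subseteq> X \<and> real (card F) \<le> C * (R / r) powr s \<and>
           X \<inter> cball x R \<subseteq> (\<Union>y\<in>F. cball y r)))}"
    proof (intro CollectI conjI exI[of _ 36] ballI allI impI)
      fix x and r R :: real assume "0 < r \<and> r < R"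
      then show "\<exists>F. finite F \<and> F \<subseteq> X \<and> real (card F) \<le> 36 * (R / r) powr 2 \<and>
           X \<inter> cball x R \<subseteq> (\<Union>y\<in>F. cball y r)"
        using planar_covering[of r R X x] by simp
    qed simp
    then show ?case by (metis (no_types, lifting) empty_iff)
  next
    case (2 s)
    from 2 obtain C' where C': "\<forall>x\<in>X. \<forall>r R. 0 < r \<and> r < R \<longrightarrow>
      (\<exists>F. finite F \<and> F \<subseteq> X \<and> real (card F) \<le> C' * (R / r) powr s \<and>
           X \<inter> cball x R \<subseteq> (\<Union>y\<in>F. cball y r))"
      by (elim CollectE conjE exE) (rule that)
    have r: "0 < ?r" "0 \<le> ?R" using c kappa by auto
    have "\<And>m. \<exists>x a t. walk X ?r ?R m (?r / 2) x a t" using walks r(1) by simp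
    then show ?case
    proof (rule walks_imp_assouad_exponent_ge_1[OF r])
      fix x and r R :: real assume "x \<in> X" "0 < r" "r < R"
      then show "\<exists>F. finite F \<and> F \<subseteq> X \<and> real (card F) \<le> C' * (R / r) powr s \<and>
           X \<inter> cball x R \<subseteq> (\<Union>y\<in>F. cball y r)"
        by (intro C'[rule_format]) auto
    qed
  qed
qed

end
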